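(* Let $\eta$ be an uncountable regular cardinal. If $\mathrm{ULST}(\mathcal L_{\eta,\eta})=\eta$, then $\eta$ is supreme for tallness.
   Context: $\mathcal L_{\eta,\eta}$ is the infinitary logic with conjunctions/disjunctions of fewer than $\eta$ formulas and quantification over fewer than $\eta$ variables. For cardinals $\kappa\le\delta$ and $\lambda\le\kappa$, $\kappa$ is $\theta$-tall pushing up $\delta$ with closure $\lambda$ if there is an elementary embedding $j:V\to M$ ($M$ transitive) with critical point $\kappa$, $M^\lambda\subseteq M$ and $j(\delta)>\theta$. A cardinal $\delta$ is supreme for tallness if for all $\lambda<\delta$ and all ordinals $\theta$ there is a cardinal $\kappa$ with $\lambda<\kappa\le\delta$ that is $\theta$-tall pushing up $\delta$ with closure $\lambda$. $\mathrm{ULST}(\mathcal L)$ is the least cardinal $\delta$ such that for every language $\tau$, every $\mathcal L(\tau)$-sentence $\varphi$, every $\tau$-structure $M\models_{\mathcal L}\varphi$ with $|M|=\gamma\ge\delta$ and every cardinal $\bar\gamma>\gamma$, there is a $\tau$-structure $\bar M\models_{\mathcal L}\varphi$ of size $\ge\bar\gamma$ with $M$ a substructure of $\bar M$. *)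

theory Defs
  imports Main "HOL-Library.Equipollence" "HOL-Library.Countable_Set"
begin

section \<open>The set-theoretic universe\<close>

text \<open>
  The universe \<open>V\<close> is a type whose elements are the sets; sets in the sense of HOL over this type
  play the role of classes, and the axioms are those of ZFC with Separation, Replacement and
  Foundation in their class form. The axiom of choice is not listed because it follows from
  Hilbert choice together with Replacement.
\<close>

class zfc_universe =
  fixes elts :: "'a \<Rightarrow> 'a set"
  assumes extensionality: "elts x = elts y \<Longrightarrow> x = y"
    and foundation: "wf {(x, y). x \<in> elts y}"
    and pairing: "\<exists>z. elts z = {x, y}"
    and union: "\<exists>z. elts z = (\<Union>y\<in>elts x. elts y)"
    and power_set: "\<exists>z. elts z = {y. elts y \<subseteq> elts x}"
    and infinity: "\<exists>w. (\<exists>e\<in>elts w. elts e = {}) \<and>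
                       (\<forall>x\<in>elts w. \<exists>y\<in>elts w. elts y = insert x (elts x))"
    and separation: "\<exists>z. elts z = {y \<in> elts x. P y}"
    and replacement: "\<exists>z. elts z = f ` elts x"

text \<open>The set with a given extension; unspecified if the class \<open>A\<close> is proper.\<close>

definition vset :: "'v::zfc_universe set \<Rightarrow> 'v" where
  "vset A = (SOME x. elts x = A)"

definition vpair :: "'v::zfc_universe \<Rightarrow> 'v \<Rightarrow> 'v" where
  "vpair x y = vset {vset {x}, vset {x, y}}"

definition transitive_class :: "'v::zfc_universe set \<Rightarrow> bool" where
  "transitive_class A \<longleftrightarrow> (\<forall>x\<in>A. elts x \<subseteq> A)"

definition Ord :: "'v::zfc_universe \<Rightarrow> bool" where
  "Ord \<alpha> \<longleftrightarrow> transitive_class (elts \<alpha>) \<and> (\<forall>\<beta>\<in>elts \<alpha>. transitive_class (elts \<beta>))"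

text \<open>On ordinals, \<open>\<alpha> < \<beta>\<close> is \<open>\<alpha> \<in> elts \<beta>\<close>.\<close>

definition ord_le :: "'v::zfc_universe \<Rightarrow> 'v \<Rightarrow> bool" where
  "ord_le \<alpha> \<beta> \<longleftrightarrow> \<alpha> \<in> elts \<beta> \<or> \<alpha> = \<beta>"

text \<open>
  By Replacement, a HOL function restricted to a set is a set, so (in)equalities of cardinality
  in \<open>V\<close> are those of the extensions.
\<close>

definition Card :: "'v::zfc_universe \<Rightarrow> bool" where
  "Card \<kappa> \<longleftrightarrow> Ord \<kappa> \<and> (\<forall>\<alpha>\<in>elts \<kappa>. \<not> elts \<alpha> \<approx> elts \<kappa>)"

definition regular_Card :: "'v::zfc_universe \<Rightarrow> bool" where
  "regular_Card \<kappa> \<longleftrightarrow> Card \<kappa> \<and> infinite (elts \<kappa>) \<and>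
     (\<forall>\<alpha>\<in>elts \<kappa>. \<forall>f. f ` elts \<alpha> \<subseteq> elts \<kappa> \<longrightarrow> (\<exists>\<beta>\<in>elts \<kappa>. f ` elts \<alpha> \<subseteq> elts \<beta>))"


section \<open>Languages and structures\<close>

text \<open>Constants are function symbols of arity 0.\<close>

record 'v language =
  fun_syms :: 'v
  rel_syms :: 'v
  fun_arity :: "'v \<Rightarrow> nat"
  rel_arity :: "'v \<Rightarrow> nat"

text \<open>Only the interpretation of the symbols of the language on the domain is relevant.\<close>

record 'v struct =
  carrier :: 'v
  fun_int :: "'v \<Rightarrow> 'v list \<Rightarrow> 'v"
  rel_int :: "'v \<Rightarrow> 'v list \<Rightarrow> bool"

definition is_struct :: "'v::zfc_universe language \<Rightarrow> 'v struct \<Rightarrow> bool" where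
  "is_struct \<tau> M \<longleftrightarrow> elts (carrier M) \<noteq> {} \<and>
     (\<forall>f\<in>elts (fun_syms \<tau>). \<forall>xs. length xs = fun_arity \<tau> f \<and> set xs \<subseteq> elts (carrier M)
        \<longrightarrow> fun_int M f xs \<in> elts (carrier M))"

definition substructure :: "'v::zfc_universe language \<Rightarrow> 'v struct \<Rightarrow> 'v struct \<Rightarrow> bool" where
  "substructure \<tau> M N \<longleftrightarrow> elts (carrier M) \<subseteq> elts (carrier N) \<and>
     (\<forall>f\<in>elts (fun_syms \<tau>). \<forall>xs. length xs = fun_arity \<tau> f \<and> set xs \<subseteq> elts (carrier M)
        \<longrightarrow> fun_int M f xs = fun_int N f xs) \<and>
     (\<forall>R\<in>elts (rel_syms \<tau>). \<forall>xs. length xs = rel_arity \<tau> R \<and> set xs \<subseteq> elts (carrier M)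
        \<longrightarrow> (rel_int M R xs \<longleftrightarrow> rel_int N R xs))"


section \<open>The logics \<open>L\<^bsub>\<kappa>,\<mu>\<^esub>\<close>\<close>

text \<open>
  Variables, symbols and indices are elements of \<open>V\<close>. In \<open>Conj I F\<close> and \<open>Disj I F\<close>, the values
  of \<open>F\<close> outside \<open>I\<close> play no role. \<open>All X \<phi>\<close> and \<open>Ex X \<phi>\<close> bind all variables in \<open>X\<close>
  simultaneously.
\<close>

datatype 'v trm = Var 'v | App 'v "'v trm list"

datatype 'v fm =
    Equal "'v trm" "'v trm"
  | Rel 'v "'v trm list"
  | Neg "'v fm"
  | Conj "'v set" "'v \<Rightarrow> 'v fm"
  | Disj "'v set" "'v \<Rightarrow> 'v fm"
  | All "'v set" "'v fm"
  | Ex "'v set" "'v fm"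

fun is_trm :: "'v::zfc_universe language \<Rightarrow> 'v trm \<Rightarrow> bool" where
  "is_trm \<tau> (Var x) \<longleftrightarrow> True"
| "is_trm \<tau> (App f ts) \<longleftrightarrow>
     f \<in> elts (fun_syms \<tau>) \<and> length ts = fun_arity \<tau> f \<and> (\<forall>t\<in>set ts. is_trm \<tau> t)"

fun fv_trm :: "'v trm \<Rightarrow> 'v set" where
  "fv_trm (Var x) = {x}"
| "fv_trm (App f ts) = (\<Union>t\<in>set ts. fv_trm t)"

fun eval_trm :: "'v struct \<Rightarrow> ('v \<Rightarrow> 'v) \<Rightarrow> 'v trm \<Rightarrow> 'v" where
  "eval_trm M s (Var x) = s x"
| "eval_trm M s (App f ts) = fun_int M f (map (eval_trm M s) ts)"

primrec is_fm :: "'v::zfc_universe \<Rightarrow> 'v \<Rightarrow> 'v language \<Rightarrow> 'v fm \<Rightarrow> bool" where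
  "is_fm \<kappa> \<mu> \<tau> (Equal t u) \<longleftrightarrow> is_trm \<tau> t \<and> is_trm \<tau> u"
| "is_fm \<kappa> \<mu> \<tau> (Rel R ts) \<longleftrightarrow>
     R \<in> elts (rel_syms \<tau>) \<and> length ts = rel_arity \<tau> R \<and> (\<forall>t\<in>set ts. is_trm \<tau> t)"
| "is_fm \<kappa> \<mu> \<tau> (Neg \<phi>) \<longleftrightarrow> is_fm \<kappa> \<mu> \<tau> \<phi>"
| "is_fm \<kappa> \<mu> \<tau> (Conj I F) \<longleftrightarrow> I \<prec> elts \<kappa> \<and> (\<forall>i\<in>I. is_fm \<kappa> \<mu> \<tau> (F i))"
| "is_fm \<kappa> \<mu> \<tau> (Disj I F) \<longleftrightarrow> I \<prec> elts \<kappa> \<and> (\<forall>i\<in>I. is_fm \<kappa> \<mu> \<tau> (F i))"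
| "is_fm \<kappa> \<mu> \<tau> (All X \<phi>) \<longleftrightarrow> X \<prec> elts \<mu> \<and> is_fm \<kappa> \<mu> \<tau> \<phi>"
| "is_fm \<kappa> \<mu> \<tau> (Ex X \<phi>) \<longleftrightarrow> X \<prec> elts \<mu> \<and> is_fm \<kappa> \<mu> \<tau> \<phi>"

primrec fv :: "'v fm \<Rightarrow> 'v set" where
  "fv (Equal t u) = fv_trm t \<union> fv_trm u"
| "fv (Rel R ts) = (\<Union>t\<in>set ts. fv_trm t)"
| "fv (Neg \<phi>) = fv \<phi>"
| "fv (Conj I F) = (\<Union>i\<in>I. fv (F i))"
| "fv (Disj I F) = (\<Union>i\<in>I. fv (F i))"
| "fv (All X \<phi>) = fv \<phi> - X"
| "fv (Ex X \<phi>) = fv \<phi> - X"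

primrec sat :: "'v::zfc_universe struct \<Rightarrow> 'v fm \<Rightarrow> ('v \<Rightarrow> 'v) \<Rightarrow> bool" where
  "sat M (Equal t u) s \<longleftrightarrow> eval_trm M s t = eval_trm M s u"
| "sat M (Rel R ts) s \<longleftrightarrow> rel_int M R (map (eval_trm M s) ts)"
| "sat M (Neg \<phi>) s \<longleftrightarrow> \<not> sat M \<phi> s"
| "sat M (Conj I F) s \<longleftrightarrow> (\<forall>i\<in>I. sat M (F i) s)"
| "sat M (Disj I F) s \<longleftrightarrow> (\<exists>i\<in>I. sat M (F i) s)"
| "sat M (All X \<phi>) s \<longleftrightarrow> (\<forall>a. a ` X \<subseteq> elts (carrier M) \<longrightarrow> sat M \<phi> (override_on s a X))"
| "sat M (Ex X \<phi>) s \<longleftrightarrow> (\<exists>a. a ` X \<subseteq> elts (carrier M) \<and> sat M \<phi> (override_on s a X))"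

definition L_sentence :: "'v::zfc_universe \<Rightarrow> 'v \<Rightarrow> 'v language \<Rightarrow> 'v fm \<Rightarrow> bool" where
  "L_sentence \<kappa> \<mu> \<tau> \<phi> \<longleftrightarrow> is_fm \<kappa> \<mu> \<tau> \<phi> \<and> fv \<phi> = {}"

definition L_models :: "'v::zfc_universe struct \<Rightarrow> 'v fm \<Rightarrow> bool" where
  "L_models M \<phi> \<longleftrightarrow> (\<forall>s. range s \<subseteq> elts (carrier M) \<longrightarrow> sat M \<phi> s)"


section \<open>Upward Loewenheim-Skolem-Tarski numbers\<close>

text \<open>
  A logic is given by its sentences \<open>Sent\<close> over each language and its satisfaction relation \<open>Mod\<close>.
\<close>

definition ULST_bound ::
  "('v::zfc_universe language \<Rightarrow> 'p \<Rightarrow> bool) \<Rightarrow> ('v struct \<Rightarrow> 'p \<Rightarrow> bool) \<Rightarrow> 'v \<Rightarrow> bool" where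
  "ULST_bound Sent Mod \<delta> \<longleftrightarrow>
     (\<forall>\<tau> \<phi> M \<gamma> \<gamma>'. Sent \<tau> \<phi> \<and> is_struct \<tau> M \<and> Mod M \<phi> \<and>
        Card \<gamma> \<and> elts (carrier M) \<approx> elts \<gamma> \<and> ord_le \<delta> \<gamma> \<and> Card \<gamma>' \<and> \<gamma> \<in> elts \<gamma>' \<longrightarrow>
        (\<exists>N. is_struct \<tau> N \<and> Mod N \<phi> \<and> elts \<gamma>' \<lesssim> elts (carrier N) \<and> substructure \<tau> M N))"

text \<open>
  \<open>is_ULST Sent Mod \<delta>\<close> says that the number exists and equals \<open>\<delta>\<close>. A relation is used because
  the number need not exist.
\<close>

definition is_ULST ::
  "('v::zfc_universe language \<Rightarrow> 'p \<Rightarrow> bool) \<Rightarrow> ('v struct \<Rightarrow> 'p \<Rightarrow> bool) \<Rightarrow> 'v \<Rightarrow> bool" where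
  "is_ULST Sent Mod \<delta> \<longleftrightarrow> Card \<delta> \<and> ULST_bound Sent Mod \<delta> \<and>
     (\<forall>\<delta>'. Card \<delta>' \<and> ULST_bound Sent Mod \<delta>' \<longrightarrow> ord_le \<delta> \<delta>')"


section \<open>Elementary embeddings and tallness\<close>

text \<open>First-order formulas of the language of set theory, with variables numbered by \<open>nat\<close>.\<close>

datatype set_fm =
    SMem nat nat
  | SEq nat nat
  | SNeg set_fm
  | SAnd set_fm set_fm
  | SEx nat set_fm

primrec set_sat :: "'v::zfc_universe set \<Rightarrow> set_fm \<Rightarrow> (nat \<Rightarrow> 'v) \<Rightarrow> bool" where
  "set_sat A (SMem m n) s \<longleftrightarrow> s m \<in> elts (s n)"
| "set_sat A (SEq m n) s \<longleftrightarrow> s m = s n"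
| "set_sat A (SNeg \<phi>) s \<longleftrightarrow> \<not> set_sat A \<phi> s"
| "set_sat A (SAnd \<phi> \<psi>) s \<longleftrightarrow> set_sat A \<phi> s \<and> set_sat A \<psi> s"
| "set_sat A (SEx n \<phi>) s \<longleftrightarrow> (\<exists>a\<in>A. set_sat A \<phi> (s(n := a)))"

definition elementary_embedding :: "('v::zfc_universe \<Rightarrow> 'v) \<Rightarrow> 'v set \<Rightarrow> bool" where
  "elementary_embedding j M \<longleftrightarrow>
     range j \<subseteq> M \<and> (\<forall>\<phi> s. set_sat UNIV \<phi> s \<longleftrightarrow> set_sat M \<phi> (j \<circ> s))"

definition critical_point :: "('v::zfc_universe \<Rightarrow> 'v) \<Rightarrow> 'v \<Rightarrow> bool" where
  "critical_point j \<kappa> \<longleftrightarrow> Ord \<kappa> \<and> j \<kappa> \<noteq> \<kappa> \<and> (\<forall>\<alpha>\<in>elts \<kappa>. j \<alpha> = \<alpha>)"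

text \<open>
  \<open>M\<^sup>\<nu> \<subseteq> M\<close>: by Replacement, the functions from \<open>\<nu>\<close> to \<open>M\<close> are exactly the graphs of HOL functions
  restricted to \<open>\<nu>\<close>.
\<close>

definition closed_under_sequences :: "'v::zfc_universe \<Rightarrow> 'v set \<Rightarrow> bool" where
  "closed_under_sequences \<nu> M \<longleftrightarrow>
     (\<forall>f. f ` elts \<nu> \<subseteq> M \<longrightarrow> vset ((\<lambda>x. vpair x (f x)) ` elts \<nu>) \<in> M)"

text \<open>\<open>\<kappa>\<close> is \<open>\<theta>\<close>-tall pushing up \<open>\<delta>\<close> with closure \<open>\<nu>\<close>.\<close>

definition tall_pushing_up ::
  "'v::zfc_universe \<Rightarrow> 'v \<Rightarrow> 'v \<Rightarrow> 'v \<Rightarrow> bool" where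
  "tall_pushing_up \<kappa> \<theta> \<delta> \<nu> \<longleftrightarrow>
     Card \<kappa> \<and> Card \<delta> \<and> Card \<nu> \<and> ord_le \<kappa> \<delta> \<and> ord_le \<nu> \<kappa> \<and>
     (\<exists>j M. transitive_class M \<and> elementary_embedding j M \<and> critical_point j \<kappa> \<and>
        closed_under_sequences \<nu> M \<and> \<theta> \<in> elts (j \<delta>))"

definition supreme_for_tallness :: "'v::zfc_universe \<Rightarrow> bool" where
  "supreme_for_tallness \<delta> \<longleftrightarrow> Card \<delta> \<and>
     (\<forall>\<nu> \<theta>. Card \<nu> \<and> \<nu> \<in> elts \<delta> \<and> Ord \<theta> \<longrightarrow>
        (\<exists>\<kappa>. Card \<kappa> \<and> \<nu> \<in> elts \<kappa> \<and> ord_le \<kappa> \<delta> \<and> tall_pushing_up \<kappa> \<theta> \<delta> \<nu>))"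

end

theory Submission
  imports Defs
begin

text \<open>
  Let \<open>D = P(\<eta>)\<close> and consider the structure \<open>P(D)\<close> with membership, together with unary functions that
  decode \<open>\<mu>\<close>-sequences of elements of \<open>D\<close> and of subsets of \<open>D\<close>, for an infinite \<open>\<mu> < \<eta>\<close> above \<open>\<nu>\<close>. A
  single sentence with fewer than \<open>\<eta>\<close> conjuncts states extensionality, the closure of \<open>D\<close> under
  \<open>\<mu>\<close>-sequences, and the correctness of names for intersections of \<open>\<mu>\<close> sets, preimages and equalizers.
  In an extension satisfying it, every new element \<open>a\<close> of \<open>D\<close> defines the \<open>\<mu>\<^sup>+\<close>-complete ultrafilter of
  the sets \<open>X \<subseteq> D\<close> in the original structure with \<open>a \<in> X\<close>. The ultrapowers of \<open>V\<close> by these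
  ultrafilters form a directed system; its limit is well-founded and closed under \<open>\<mu>\<close>-sequences, and
  the embedding \<open>j\<close> fixes the ordinals up to \<open>\<mu>\<close>. By extensionality, the size of the extension is at
  most the double power of the number of new elements of \<open>\<eta>\<close>, and the latter inject into \<open>j(\<eta>)\<close>. So a
  large extension makes \<open>j(\<eta>)\<close> exceed both \<open>\<theta>\<close> and \<open>\<eta>\<close>, and the critical point of \<open>j\<close> is as required.
\<close>

section \<open>Small classes\<close>

definition small :: "'v::zfc_universe set \<Rightarrow> bool" where
  "small A \<longleftrightarrow> (\<exists>x. elts x = A)"

lemma elts_vset [simp]: "small A \<Longrightarrow> elts (vset A) = A"
  unfolding small_def vset_def by (rule someI_ex)

lemma small_elts [simp]: "small (elts x)"
  unfolding small_def by blast

lemma vset_elts [simp]: "vset (elts x) = x"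
  by (simp add: extensionality)

lemma small_subset:
  assumes "small B" "A \<subseteq> B"
  shows "small A"
proof -
  from assms obtain b where "elts b = B" by (auto simp: small_def)
  moreover obtain z where "elts z = {y \<in> elts b. y \<in> A}" using separation[of b "\<lambda>y. y \<in> A"] by blast
  ultimately show "small A" using \<open>A \<subseteq> B\<close> unfolding small_def by (intro exI[of _ z]) auto
qed

lemma small_image [simp]:
  fixes f :: "'v::zfc_universe \<Rightarrow> 'v"
  assumes "small B"
  shows "small (f ` B)"
proof -
  from assms obtain b where "elts b = B" by (auto simp: small_def)
  then show ?thesis using replacement[of f b] by (simp add: small_def)
qed

lemma small_pair [simp]: "small {x, y}"
  unfolding small_def by (rule pairing)

lemma small_singleton [simp]: "small {x}"
  using small_pair[of x x] by simp

lemma small_empty [simp]: "small {}"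
  by (rule small_subset[OF small_elts]) simp

lemma small_UN:
  fixes B :: "'v::zfc_universe \<Rightarrow> 'v set"
  assumes A: "small A" and B: "\<And>x. x \<in> A \<Longrightarrow> small (B x)"
  shows "small (\<Union>x\<in>A. B x)"
proof -
  obtain a where a: "elts a = (\<lambda>x. vset (B x)) ` A" using small_image[OF A, of "\<lambda>x. vset (B x)"] by (auto simp: small_def)
  obtain z where "elts z = (\<Union>y\<in>elts a. elts y)" using union by blast
  also have "\<dots> = (\<Union>x\<in>A. B x)" using B by (simp add: a)
  finally show ?thesis unfolding small_def by blast
qed

lemma small_Un:
  assumes A: "small A" and B: "small B"
  shows "small (A \<union> B)"
proof -
  have "small (\<Union>x\<in>{vset A, vset B}. elts x)" by (intro small_UN) auto
  then show ?thesis using A B by simp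
qed

lemma small_Pow: "small {x. elts x \<subseteq> elts a}"
  unfolding small_def by (rule power_set)

text \<open>\<open>A\<close> may have any type, so that a collection of pairs of a function and a
  seed can also be shown to have a small image. A surjection from \<open>elts x\<close> reduces it
  to Replacement.\<close>

lemma small_lepoll:
  fixes x :: "'v::zfc_universe" and f :: "'a \<Rightarrow> 'v"
  assumes "A \<lesssim> elts x"
  shows "small (f ` A)"
proof -
  from assms obtain g where "A \<subseteq> g ` elts x" by (auto simp: lepoll_iff)
  then have "f ` A \<subseteq> (\<lambda>y. f (g y)) ` elts x" by auto
  then show ?thesis by (rule small_subset[rotated]) simp
qed

lemma small_lepoll':
  fixes A :: "'v::zfc_universe set" and x :: 'v
  shows "A \<lesssim> elts x \<Longrightarrow> small A"
  using small_lepoll[of A x "\<lambda>y. y"] by simp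

text \<open>If \<open>g\<close> maps \<open>elts x\<close> onto a superset of \<open>A\<close>, then
  each subset of \<open>A\<close> is the \<open>g\<close>-image of a subset of
  \<open>elts x\<close>, which is a set by Separation.\<close>

lemma Pow_lepoll_elts:
  assumes "A \<lesssim> elts x"
  shows "Pow A \<lesssim> {y. elts y \<subseteq> elts x}"
proof -
  from assms obtain g where g: "A \<subseteq> g ` elts x" by (auto simp: lepoll_iff)
  have "Pow A \<subseteq> (\<lambda>y. g ` elts y) ` {y. elts y \<subseteq> elts x}"
  proof
    fix X assume "X \<in> Pow A"
    define Y where "Y = {y \<in> elts x. g y \<in> X}"
    have "small Y" by (rule small_subset[of "elts x"]) (auto simp: Y_def)
    moreover have "g ` Y = X" using g \<open>X \<in> Pow A\<close> unfolding Y_def by blast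
    ultimately show "X \<in> (\<lambda>y. g ` elts y) ` {y. elts y \<subseteq> elts x}"
      by (intro image_eqI[of _ _ "vset Y"]) (auto simp: Y_def)
  qed
  then show ?thesis by (auto simp: lepoll_iff)
qed

definition vPow :: "'v::zfc_universe \<Rightarrow> 'v" where
  "vPow x = vset {y. elts y \<subseteq> elts x}"

lemma elts_vPow [simp]: "elts (vPow x) = {y. elts y \<subseteq> elts x}"
  by (simp add: vPow_def small_Pow)

lemma Pow_eqpoll_vPow: "Pow (elts x) \<approx> elts (vPow x)"
proof -
  have "inj_on elts {y. elts y \<subseteq> elts x}" by (auto simp: inj_on_def intro: extensionality)
  moreover have "elts ` {y. elts y \<subseteq> elts x} = Pow (elts x)"
  proof -
    have "X \<in> elts ` {y. elts y \<subseteq> elts x}" if "X \<subseteq> elts x" for X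
      using small_subset[OF small_elts that] that by (intro image_eqI[of _ _ "vset X"]) auto
    then show ?thesis by auto
  qed
  ultimately show ?thesis
    by (metis eqpoll_sym elts_vPow inj_on_image_eqpoll_self)
qed

lemma mem_irrefl: "x \<notin> elts x"
  using foundation[where 'a='a] wf_not_refl by fastforce

lemma mem_induct [case_names step]: "(\<And>x. (\<And>y. y \<in> elts x \<Longrightarrow> P y) \<Longrightarrow> P x) \<Longrightarrow> P x"
  using wf_induct[OF foundation, of P x] by simp

lemma not_small_UNIV: "\<not> small (UNIV :: 'v::zfc_universe set)"
  using mem_irrefl unfolding small_def by blast

lemma Times_same_lepoll: "infinite A \<Longrightarrow> A \<times> A \<lesssim> A"
  using card_of_Times_same_infinite[of A] eqpoll_iff_card_of_ordIso eqpoll_imp_lepoll by blast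

text \<open>The successor iterates of the empty set are distinct: an earlier one belongs to every
  later one, and no set belongs to itself.\<close>

lemma infinite_elts_ex: "\<exists>w::'v::zfc_universe. infinite (elts w)"
proof -
  obtain w :: 'v and e where e: "e \<in> elts w" "elts e = {}"
    and w: "\<forall>x\<in>elts w. \<exists>y\<in>elts w. elts y = insert x (elts x)"
    using infinity by blast
  obtain f where f: "\<And>x. x \<in> elts w \<Longrightarrow> f x \<in> elts w \<and> elts (f x) = insert x (elts x)"
    using w by metis
  define g where "g n = (f ^^ n) e" for n
  have gw: "g n \<in> elts w" for n by (induction n) (auto simp: g_def e f)
  have gS: "elts (g (Suc n)) = insert (g n) (elts (g n))" for n using f[OF gw[of n]] by (simp add: g_def)
  have mem: "m < n \<Longrightarrow> g m \<in> elts (g n)" for m n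
    by (induction n) (auto simp: gS less_Suc_eq)
  have "inj g"
    by (metis injI linorder_neqE_nat mem mem_irrefl)
  then have "infinite (range g)" using range_inj_infinite by blast
  then show ?thesis using gw finite_subset[of "range g" "elts w"] by blast
qed

text \<open>Any two sets embed into one infinite set, which absorbs their product.\<close>

lemma lepoll_Times_elts:
  fixes a b :: "'v::zfc_universe"
  assumes "A \<lesssim> elts a" "B \<lesssim> elts b"
  shows "\<exists>z::'v. A \<times> B \<lesssim> elts z"
proof -
  obtain w :: 'v where "infinite (elts w)" using infinite_elts_ex by blast
  define z where "z = vset (elts a \<union> elts b \<union> elts w)"
  have z: "elts z = elts a \<union> elts b \<union> elts w" by (simp add: z_def small_Un)
  then have "infinite (elts z)" using \<open>infinite (elts w)\<close> by simp
  have "A \<lesssim> elts z" "B \<lesssim> elts z"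
    by (metis assms z lepoll_trans subset_imp_lepoll Un_upper1 Un_upper2 le_supI1)+
  then have "A \<times> B \<lesssim> elts z \<times> elts z" by (rule times_lepoll_mono)
  also have "\<dots> \<lesssim> elts z" by (rule Times_same_lepoll) fact
  finally show ?thesis by blast
qed

text \<open>A function is determined by its graph, which is a subset of a product. Restricting to
  extensional functions removes the arbitrary values off \<open>D\<close>, which would make a proper
  class.\<close>

lemma lepoll_extensional:
  fixes D W :: "'v::zfc_universe"
  shows "\<exists>z::'v. (elts D \<rightarrow>\<^sub>E elts W) \<lesssim> elts z"
proof -
  obtain p :: 'v where p: "elts D \<times> elts W \<lesssim> elts p" using lepoll_Times_elts by blast
  have "inj_on (\<lambda>g. (\<lambda>d. (d, g d)) ` elts D) (elts D \<rightarrow>\<^sub>E elts W)"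
  proof (rule inj_onI)
    fix f g assume fg: "f \<in> elts D \<rightarrow>\<^sub>E elts W" "g \<in> elts D \<rightarrow>\<^sub>E elts W"
      and eq: "(\<lambda>d. (d, f d)) ` elts D = (\<lambda>d. (d, g d)) ` elts D"
    show "f = g"
    proof (rule PiE_ext[OF fg])
      fix d assume "d \<in> elts D"
      then have "(d, f d) \<in> (\<lambda>d. (d, g d)) ` elts D" unfolding eq[symmetric] by blast
      then show "f d = g d" by auto
    qed
  qed
  then have "(elts D \<rightarrow>\<^sub>E elts W) \<lesssim> Pow (elts D \<times> elts W)"
    unfolding lepoll_def by (rule_tac exI, intro conjI, assumption) auto
  also have "\<dots> \<lesssim> elts (vPow p)" using Pow_lepoll_elts[OF p] by simp
  finally show ?thesis by blast
qed

section \<open>Ordinals and cardinals\<close>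

lemma Ord_mem: "Ord \<alpha> \<Longrightarrow> \<beta> \<in> elts \<alpha> \<Longrightarrow> Ord \<beta>"
  unfolding Ord_def transitive_class_def by blast

lemma Ord_trans: "Ord \<alpha> \<Longrightarrow> \<beta> \<in> elts \<alpha> \<Longrightarrow> \<gamma> \<in> elts \<beta> \<Longrightarrow> \<gamma> \<in> elts \<alpha>"
  unfolding Ord_def transitive_class_def by blast

lemma Ord_subset: "Ord \<alpha> \<Longrightarrow> \<beta> \<in> elts \<alpha> \<Longrightarrow> elts \<beta> \<subseteq> elts \<alpha>"
  using Ord_trans by blast

lemma OrdI:
  assumes "\<And>\<beta> \<gamma>. \<beta> \<in> elts \<alpha> \<Longrightarrow> \<gamma> \<in> elts \<beta> \<Longrightarrow> \<gamma> \<in> elts \<alpha>" and "\<And>\<beta>. \<beta> \<in> elts \<alpha> \<Longrightarrow> Ord \<beta>"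
  shows "Ord \<alpha>"
  unfolding Ord_def
proof (intro conjI ballI)
  show "transitive_class (elts \<alpha>)" using assms(1) by (auto simp: transitive_class_def)
  show "transitive_class (elts \<beta>)" if "\<beta> \<in> elts \<alpha>" for \<beta> using assms(2)[OF that] by (simp add: Ord_def)
qed

text \<open>Membership induction on both sides: if neither ordinal belongs to the other, each member
  of one belongs to the other, and extensionality applies.\<close>

lemma Ord_linear: "Ord \<alpha> \<Longrightarrow> Ord \<beta> \<Longrightarrow> \<alpha> \<in> elts \<beta> \<or> \<alpha> = \<beta> \<or> \<beta> \<in> elts \<alpha>"
proof (induction \<alpha> arbitrary: \<beta> rule: mem_induct)
  case (step \<alpha>)
  note IH1 = step.IH and \<alpha> = step.prems(1)
  show ?case using \<open>Ord \<beta>\<close>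
  proof (induction \<beta> rule: mem_induct)
    case (step \<beta>)
    have *: "\<alpha> \<in> elts \<delta> \<or> \<alpha> = \<delta> \<or> \<delta> \<in> elts \<alpha>" if "\<delta> \<in> elts \<beta>" for \<delta>
      by (rule step.IH[OF that Ord_mem[OF step.prems that]])
    have **: "\<gamma> \<in> elts \<beta> \<or> \<gamma> = \<beta> \<or> \<beta> \<in> elts \<gamma>" if "\<gamma> \<in> elts \<alpha>" for \<gamma>
      by (rule IH1[OF that Ord_mem[OF \<alpha> that] step.prems])
    show ?case
    proof (rule ccontr)
      assume neg: "\<not> ?thesis"
      have "elts \<alpha> = elts \<beta>"
      proof (intro subset_antisym subsetI)
        show "\<gamma> \<in> elts \<beta>" if "\<gamma> \<in> elts \<alpha>" for \<gamma>
          using **[OF that] neg that Ord_trans[OF \<alpha> that] by blast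
        show "\<delta> \<in> elts \<alpha>" if "\<delta> \<in> elts \<beta>" for \<delta>
          using *[OF that] neg that Ord_trans[OF step.prems that] by blast
      qed
      then have "\<alpha> = \<beta>" by (rule extensionality)
      then show False using neg by simp
    qed
  qed
qed

lemma Ord_not_mem: "Ord \<alpha> \<Longrightarrow> Ord \<beta> \<Longrightarrow> \<alpha> \<notin> elts \<beta> \<Longrightarrow> elts \<beta> \<subseteq> elts \<alpha>"
  using Ord_linear Ord_subset by blast

text \<open>The bound by \<alpha> is kept in the conclusion because it later places the critical
  point at or below \<eta>.\<close>

lemma Ord_least:
  assumes "P \<alpha>" and "Ord \<alpha>"
  shows "\<exists>\<beta>. P \<beta> \<and> Ord \<beta> \<and> ord_le \<beta> \<alpha> \<and> (\<forall>\<gamma>\<in>elts \<beta>. \<not> P \<gamma>)"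
  using assms
proof (induction \<alpha> rule: mem_induct)
  case (step \<alpha>)
  show ?case
  proof (cases "\<exists>\<gamma>\<in>elts \<alpha>. P \<gamma>")
    case True
    then obtain \<gamma> where \<gamma>: "\<gamma> \<in> elts \<alpha>" "P \<gamma>" by blast
    from step.IH[OF this Ord_mem[OF step.prems(2) this(1)]] show ?thesis
      using Ord_trans[OF step.prems(2) \<gamma>(1)] \<gamma>(1) unfolding ord_le_def by blast
  next
    case False
    then show ?thesis using step.prems unfolding ord_le_def by blast
  qed
qed

text \<open>Burali-Forti: a set of all ordinals would be an ordinal and so a member of
  itself.\<close>

lemma not_small_Ord: "\<not> small {\<alpha> :: 'v::zfc_universe. Ord \<alpha>}"
proof
  assume "small {\<alpha> :: 'v. Ord \<alpha>}"
  then obtain o' :: 'v where o': "elts o' = {\<alpha>. Ord \<alpha>}" by (auto simp: small_def)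
  have "Ord o'" by (rule OrdI) (auto simp: o' intro: Ord_mem)
  then show False using o' mem_irrefl[of o'] by blast
qed

text \<open>A recursion along the ordinals enumerates the set without repetition until it is exhausted.\<close>

lemma ex_Ord_eqpoll:
  fixes x :: "'v::zfc_universe"
  shows "\<exists>\<alpha>::'v. Ord \<alpha> \<and> elts x \<approx> elts \<alpha>"
proof -
  define F where "F f \<alpha> = (SOME y. y \<in> elts x \<and> y \<notin> f ` elts \<alpha>)" for f :: "'v \<Rightarrow> 'v" and \<alpha>
  define g where "g = wfrec {(x, y). x \<in> elts y} F"
  have g: "g \<alpha> = (SOME y. y \<in> elts x \<and> y \<notin> g ` elts \<alpha>)" for \<alpha>
  proof -
    have "g \<alpha> = F (cut g {(x, y). x \<in> elts y} \<alpha>) \<alpha>"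
      unfolding g_def by (rule wfrec[OF foundation])
    moreover have "cut g {(x, y). x \<in> elts y} \<alpha> ` elts \<alpha> = g ` elts \<alpha>"
      by (rule image_cong) (auto simp: cut_apply)
    ultimately show ?thesis by (simp add: F_def)
  qed
  have step: "g \<alpha> \<in> elts x \<and> g \<alpha> \<notin> g ` elts \<alpha>" if "\<not> elts x \<subseteq> g ` elts \<alpha>" for \<alpha>
    unfolding g[of \<alpha>] by (rule someI_ex) (use that in blast)
  have inj: "inj_on g A" if "A \<subseteq> {\<alpha>. Ord \<alpha>}" "\<And>\<alpha>. \<alpha> \<in> A \<Longrightarrow> \<not> elts x \<subseteq> g ` elts \<alpha>" for A
  proof (rule inj_onI)
    fix a b assume ab: "a \<in> A" "b \<in> A" "g a = g b"
    then show "a = b" using Ord_linear[of a b] step[OF that(2)[of a]] step[OF that(2)[of b]] that(1)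
      by (metis image_eqI mem_Collect_eq subsetD)
  qed
  \<comment> \<open>Otherwise \<open>g\<close> would inject the proper class of ordinals into
    \<open>elts x\<close>.\<close>
  have "\<exists>\<alpha>. Ord \<alpha> \<and> elts x \<subseteq> g ` elts \<alpha>"
  proof (rule ccontr)
    assume neg: "\<not> ?thesis"
    then have "inj_on g {\<alpha>. Ord \<alpha>}" by (intro inj) auto
    moreover have "g ` {\<alpha>. Ord \<alpha>} \<subseteq> elts x" using step neg by blast
    ultimately have "{\<alpha> :: 'v. Ord \<alpha>} \<lesssim> elts x" unfolding lepoll_def by (intro exI[of _ g] conjI)
    then have "small {\<alpha> :: 'v. Ord \<alpha>}" by (rule small_lepoll')
    then show False using not_small_Ord by contradiction
  qed
  then obtain \<alpha>\<^sub>0 where "Ord \<alpha>\<^sub>0" "elts x \<subseteq> g ` elts \<alpha>\<^sub>0" by blast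
  then obtain \<alpha> where \<alpha>: "Ord \<alpha>" "elts x \<subseteq> g ` elts \<alpha>"
    and min: "\<And>\<beta>. \<beta> \<in> elts \<alpha> \<Longrightarrow> \<not> elts x \<subseteq> g ` elts \<beta>"
    using Ord_least[of "\<lambda>\<alpha>. elts x \<subseteq> g ` elts \<alpha>" \<alpha>\<^sub>0] by blast
  have "inj_on g (elts \<alpha>)" using Ord_mem[OF \<alpha>(1)] min by (intro inj) auto
  moreover have "g ` elts \<alpha> = elts x" using \<alpha>(2) step[OF min] by blast
  ultimately have "elts \<alpha> \<approx> elts x" by (metis eqpoll_sym inj_on_image_eqpoll_self)
  then show ?thesis using \<alpha>(1) eqpoll_sym by blast
qed

lemma ex_Card_eqpoll:
  fixes x :: "'v::zfc_universe"
  shows "\<exists>\<kappa>::'v. Card \<kappa> \<and> elts x \<approx> elts \<kappa>"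
proof -
  obtain \<alpha> :: 'v where "Ord \<alpha>" "elts x \<approx> elts \<alpha>" using ex_Ord_eqpoll by blast
  then obtain \<kappa> :: 'v where \<kappa>: "elts x \<approx> elts \<kappa>" "Ord \<kappa>" "\<And>\<gamma>. \<gamma> \<in> elts \<kappa> \<Longrightarrow> \<not> elts x \<approx> elts \<gamma>"
    using Ord_least[of "\<lambda>\<alpha>. elts x \<approx> elts \<alpha>" \<alpha>] by blast
  have "\<not> elts \<gamma> \<approx> elts \<kappa>" if "\<gamma> \<in> elts \<kappa>" for \<gamma>
    using \<kappa>(3)[OF that] eqpoll_trans[OF \<kappa>(1) eqpoll_sym] by blast
  then show ?thesis using \<kappa> unfolding Card_def by blast
qed

lemma Card_imp_Ord: "Card \<kappa> \<Longrightarrow> Ord \<kappa>"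
  by (simp add: Card_def)

lemma Card_mem_lesspoll: "Card \<kappa> \<Longrightarrow> \<alpha> \<in> elts \<kappa> \<Longrightarrow> elts \<alpha> \<prec> elts \<kappa>"
  unfolding Card_def lesspoll_def by (meson Ord_subset subset_imp_lepoll)

lemma Card_lesspoll_mem: "Ord \<alpha> \<Longrightarrow> Ord \<kappa> \<Longrightarrow> elts \<alpha> \<prec> elts \<kappa> \<Longrightarrow> \<alpha> \<in> elts \<kappa>"
proof (rule ccontr)
  assume "Ord \<alpha>" "Ord \<kappa>" and less: "elts \<alpha> \<prec> elts \<kappa>" and "\<alpha> \<notin> elts \<kappa>"
  then have "elts \<kappa> \<lesssim> elts \<alpha>" by (intro subset_imp_lepoll Ord_not_mem)
  then have "elts \<kappa> \<prec> elts \<kappa>" using less by (rule lesspoll_trans1)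
  then show False by simp
qed

lemma Card_lepoll_ord_le:
  fixes \<kappa> \<alpha> :: "'v::zfc_universe"
  shows "Card \<kappa> \<Longrightarrow> Ord \<alpha> \<Longrightarrow> elts \<kappa> \<lesssim> elts \<alpha> \<Longrightarrow> ord_le \<kappa> \<alpha>"
proof (rule ccontr)
  assume \<kappa>: "Card \<kappa>" and "Ord \<alpha>" and le: "elts \<kappa> \<lesssim> elts \<alpha>" and "\<not> ord_le \<kappa> \<alpha>"
  then have "\<alpha> \<in> elts \<kappa>" using Ord_linear[of \<kappa> \<alpha>] Card_imp_Ord[of \<kappa>] by (simp add: ord_le_def)
  then have "elts \<kappa> \<prec> elts \<kappa>" using le Card_mem_lesspoll[OF \<kappa>] lesspoll_trans1 by metis
  then show False by simp
qed

text \<open>Finite elements of an ordinal are determined by their cardinalities.\<close>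

lemma uncountable_Ord_infinite_mem:
  assumes "Ord \<alpha>" "uncountable (elts \<alpha>)"
  shows "\<exists>\<beta>\<in>elts \<alpha>. infinite (elts \<beta>)"
proof (rule ccontr)
  assume neg: "\<not> ?thesis"
  have "inj_on (\<lambda>\<beta>. card (elts \<beta>)) (elts \<alpha>)"
  proof (rule inj_onI)
    have less: "card (elts \<beta>) < card (elts \<gamma>)" if "\<gamma> \<in> elts \<alpha>" "\<beta> \<in> elts \<gamma>" for \<beta> \<gamma>
    proof (rule psubset_card_mono)
      show "finite (elts \<gamma>)" using neg that by blast
      show "elts \<beta> \<subset> elts \<gamma>"
        using Ord_subset[OF Ord_mem[OF assms(1) that(1)] that(2)] that(2) mem_irrefl[of \<beta>] by blast
    qed
    fix \<beta> \<gamma> assume "\<beta> \<in> elts \<alpha>" "\<gamma> \<in> elts \<alpha>" "card (elts \<beta>) = card (elts \<gamma>)"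
    then show "\<beta> = \<gamma>" using less Ord_linear[of \<beta> \<gamma>] Ord_mem[OF assms(1)] by (metis less_irrefl)
  qed
  then show False using assms(2) countableI by blast
qed

section \<open>Direct limits of ultrapowers\<close>

text \<open>
  An element \<open>a\<close> of \<open>S\<close> is a seed whose ultrafilter on \<open>D\<close> consists of the \<open>P\<close> with \<open>al a P\<close>.
  A seed codes an \<open>I\<close>-sequence of seeds \<open>prs i a\<close>, just as an element \<open>d\<close> of \<open>D\<close> codes the
  sequence of the \<open>pr i d\<close>.
\<close>

locale seed_system =
  fixes S D :: "'v::zfc_universe" and I :: "'v set"
    and al :: "'v \<Rightarrow> ('v \<Rightarrow> bool) \<Rightarrow> bool"
    and pr prs :: "'v \<Rightarrow> 'v \<Rightarrow> 'v"
    and idx :: "nat \<Rightarrow> 'v"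
  assumes S_nonempty: "elts S \<noteq> {}"
    and inj_idx: "inj idx" and idx_I [simp, intro]: "idx n \<in> I"
    and al_D: "a \<in> elts S \<Longrightarrow> al a (\<lambda>d. d \<in> elts D)"
    and al_nand: "a \<in> elts S \<Longrightarrow> al a (\<lambda>d. \<exists>i\<in>I. \<not> R i d) \<longleftrightarrow> (\<exists>i\<in>I. \<not> al a (R i))"
    and al_pr: "a \<in> elts S \<Longrightarrow> i \<in> I \<Longrightarrow> al a (\<lambda>d. P (pr i d)) \<longleftrightarrow> al (prs i a) P"
    and seq: "(\<And>i. i \<in> I \<Longrightarrow> x i \<in> elts S) \<Longrightarrow> \<exists>a\<in>elts S. \<forall>i\<in>I. prs i a = x i"
    and al_pr_eq: "a \<in> elts S \<Longrightarrow> i \<in> I \<Longrightarrow> k \<in> I \<Longrightarrow> m \<in> I \<Longrightarrow>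
      al a (\<lambda>d. pr i (pr k d) = pr m d) \<longleftrightarrow> prs i (prs k a) = prs m a"
begin

section \<open>Logical operations on the ultrafilter of a seed\<close>

text \<open>This is \<open>al_nand\<close> for a constant family over the nonempty index set
  \<open>I\<close>.\<close>

lemma al_not: "a \<in> elts S \<Longrightarrow> al a (\<lambda>d. \<not> P d) \<longleftrightarrow> \<not> al a P"
proof -
  have [simp]: "\<exists>i. i \<in> I" using idx_I by blast
  then show "a \<in> elts S \<Longrightarrow> al a (\<lambda>d. \<not> P d) \<longleftrightarrow> \<not> al a P"
    using al_nand[of a "\<lambda>_. P"] by auto
qed

lemma al_all: "a \<in> elts S \<Longrightarrow> al a (\<lambda>d. \<forall>i\<in>I. P i d) \<longleftrightarrow> (\<forall>i\<in>I. al a (P i))"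
  using al_not[of a "\<lambda>d. \<exists>i\<in>I. \<not> P i d"] al_nand[of a P] by simp

lemma al_ex: "a \<in> elts S \<Longrightarrow> al a (\<lambda>d. \<exists>i\<in>I. P i d) \<longleftrightarrow> (\<exists>i\<in>I. al a (P i))"
  using al_nand[of a "\<lambda>i d. \<not> P i d"] by (simp add: al_not)

text \<open>\<open>inv idx\<close> reindexes conditions on numbers by \<open>I\<close>. Indices
  outside the range of \<open>idx\<close> also go to some number, so they only repeat
  conditions.\<close>

lemma al_all_nat: "a \<in> elts S \<Longrightarrow> al a (\<lambda>d. \<forall>n. P n d) \<longleftrightarrow> (\<forall>n::nat. al a (P n))"
proof -
  assume a: "a \<in> elts S"
  have inv: "inv idx (idx n) = n" for n using inj_idx by simp
  have *: "(\<forall>i\<in>I. Q (inv idx i)) \<longleftrightarrow> (\<forall>n. Q n)" for Q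
    by (metis inv idx_I)
  show "al a (\<lambda>d. \<forall>n. P n d) \<longleftrightarrow> (\<forall>n. al a (P n))"
    using al_all[OF a, of "\<lambda>i. P (inv idx i)"] *[of "\<lambda>n. al a (P n)"] *[of "\<lambda>n. P n _"] by simp
qed

lemma al_conj:
  assumes a: "a \<in> elts S"
  shows "al a (\<lambda>d. P d \<and> Q d) \<longleftrightarrow> al a P \<and> al a Q"
proof -
  have "(P d \<and> Q d) \<longleftrightarrow> (\<forall>n::nat. (if n = 0 then P else Q) d)" for d
    by (metis zero_neq_one)
  then have "al a (\<lambda>d. P d \<and> Q d) \<longleftrightarrow> (\<forall>n::nat. al a (\<lambda>d. (if n = 0 then P else Q) d))"
    using al_all_nat[OF a, of "\<lambda>n. if n = 0 then P else Q"] by simp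
  also have "\<dots> \<longleftrightarrow> al a P \<and> al a Q"
    by (auto split: if_splits)
  finally show ?thesis .
qed

lemma al_mono:
  assumes "a \<in> elts S" "al a P" "\<And>d. P d \<Longrightarrow> Q d"
  shows "al a Q"
proof -
  have "(\<lambda>d. P d \<and> Q d) = P" using assms(3) by blast
  then show ?thesis using al_conj[of a P Q] assms by simp
qed

lemma al_mp:
  assumes "a \<in> elts S" "al a P" "al a (\<lambda>d. P d \<longrightarrow> Q d)"
  shows "al a Q"
proof -
  have "al a (\<lambda>d. P d \<and> (P d \<longrightarrow> Q d))" using assms by (simp only: al_conj)
  then show ?thesis by (rule al_mono[OF assms(1)]) simp
qed

text \<open>Exactly one of the true and the false condition is large by \<open>al_not\<close>, and
  by monotonicity it cannot be the false one.\<close>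

lemma al_const [simp]:
  assumes "a \<in> elts S"
  shows "al a (\<lambda>_. P) \<longleftrightarrow> P"
proof -
  have "al a (\<lambda>_. True)"
    using al_not[OF assms, of "\<lambda>_. False"] al_mono[OF assms, of "\<lambda>_. False" "\<lambda>_. True"] by auto
  then show ?thesis using al_not[OF assms, of "\<lambda>_. True"] by (cases P) auto
qed

lemma al_cong:
  assumes "a \<in> elts S" "al a (\<lambda>d. P d = Q d)"
  shows "al a P = al a Q"
proof
  have "al a (\<lambda>d. P d \<longrightarrow> Q d)" "al a (\<lambda>d. Q d \<longrightarrow> P d)"
    using assms(2) by (auto elim: al_mono[OF assms(1)])
  then show "al a P \<Longrightarrow> al a Q" "al a Q \<Longrightarrow> al a P" using al_mp[OF assms(1)] by metis+
qed

lemma al_imp_ex: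
  assumes "a \<in> elts S" "al a P"
  shows "\<exists>d. P d"
proof (rule ccontr)
  assume "\<nexists>d. P d"
  then have "P = (\<lambda>_. False)" by auto
  then show False using assms by simp
qed

lemma seq_nat:
  assumes "\<And>n. x n \<in> elts S"
  obtains a where "a \<in> elts S" "\<And>n. prs (idx n) a = x n"
proof -
  have inv: "inv idx (idx n) = n" for n using inj_idx by simp
  from seq[of "\<lambda>i. x (inv idx i)"] assms obtain a where
    "a \<in> elts S" "\<forall>i\<in>I. prs i a = x (inv idx i)" by blast
  then show ?thesis using that[of a] inv by simp
qed

lemma seq2:
  assumes "a \<in> elts S" "b \<in> elts S"
  obtains z where "z \<in> elts S" "prs (idx 0) z = a" "prs (idx 1) z = b"
proof -
  have "(if n = 0 then a else b) \<in> elts S" for n :: nat using assms by simp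
  then obtain z where "z \<in> elts S" "\<And>n. prs (idx n) z = (if n = 0 then a else b)"
    by (rule seq_nat[of "\<lambda>n. if n = 0 then a else b"]) blast
  then show ?thesis using that[of z] by simp
qed

section \<open>Comparing functions at different seeds\<close>

text \<open>A pair \<open>(f, a)\<close> stands for the class of \<open>f\<close> in the ultrapower
  by the ultrafilter of \<open>a\<close>. Two such classes are compared in the ultrapower of a seed
  \<open>c\<close> that has both seeds among its components.\<close>

definition rel :: "('v \<Rightarrow> 'v \<Rightarrow> bool) \<Rightarrow> ('v \<Rightarrow> 'v) \<times> 'v \<Rightarrow> ('v \<Rightarrow> 'v) \<times> 'v \<Rightarrow> bool" where
  "rel T x y \<longleftrightarrow> snd x \<in> elts S \<and> snd y \<in> elts S \<and>
     (\<exists>c\<in>elts S. \<exists>i\<in>I. \<exists>k\<in>I. prs i c = snd x \<and> prs k c = snd y \<and>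
        al c (\<lambda>d. T (fst x (pr i d)) (fst y (pr k d))))"

text \<open>The choice of the common seed is immaterial: a seed \<open>z\<close> coding both
  candidates and both given seeds knows by \<open>al_pr_eq\<close> that the two ways of decoding
  agree, and carries the statement from \<open>e\<close> to \<open>c\<close>.\<close>

lemma rel_indep:
  assumes e: "e \<in> elts S" "i \<in> I" "k \<in> I" and c: "c \<in> elts S" "m \<in> I" "n \<in> I"
    and a: "prs i e = a" "prs m c = a" "a \<in> elts S" and b: "prs k e = b" "prs n c = b" "b \<in> elts S"
    and "al e (\<lambda>d. T (f (pr i d)) (g (pr k d)))"
  shows "al c (\<lambda>d. T (f (pr m d)) (g (pr n d)))"
proof -
  \<comment> \<open>Components 0 to 3 of \<open>z\<close> will be \<open>e\<close>,
    \<open>c\<close>, \<open>a\<close> and \<open>b\<close>.\<close>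
  define x where "x j = (if j = 0 then e else if j = 1 then c else if j = (2::nat) then a else b)" for j
  have "x j \<in> elts S" for j using e c a b by (simp add: x_def)
  then obtain z where z: "z \<in> elts S" "\<And>j. prs (idx j) z = x j" using seq_nat by blast
  have eq: "al z (\<lambda>d. pr h (pr (idx j) d) = pr (idx j') d)" if "prs h (x j) = x j'" "h \<in> I" for h j j'
    using al_pr_eq[OF z(1) \<open>h \<in> I\<close> idx_I idx_I] z(2) that by simp
  have 1: "al z (\<lambda>d. pr i (pr (idx 0) d) = pr (idx 2) d)" using a e by (intro eq) (auto simp: x_def)
  have 2: "al z (\<lambda>d. pr k (pr (idx 0) d) = pr (idx 3) d)" using b e by (intro eq) (auto simp: x_def)
  have 3: "al z (\<lambda>d. pr m (pr (idx 1) d) = pr (idx 2) d)" using a c by (intro eq) (auto simp: x_def)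
  have 4: "al z (\<lambda>d. pr n (pr (idx 1) d) = pr (idx 3) d)" using b c by (intro eq) (auto simp: x_def)
  have "prs (idx 0) z = e" "prs (idx 1) z = c" using z(2) by (simp_all add: x_def)
  have "al z (\<lambda>d. T (f (pr i (pr (idx 0) d))) (g (pr k (pr (idx 0) d))))"
    using al_pr[OF z(1) idx_I[of 0], of "\<lambda>d. T (f (pr i d)) (g (pr k d))"]
      \<open>prs (idx 0) z = e\<close> assms by simp
  with 1 2 3 4 have "al z (\<lambda>d. T (f (pr i (pr (idx 0) d))) (g (pr k (pr (idx 0) d))) \<and>
      pr i (pr (idx 0) d) = pr (idx 2) d \<and> pr k (pr (idx 0) d) = pr (idx 3) d \<and>
      pr m (pr (idx 1) d) = pr (idx 2) d \<and> pr n (pr (idx 1) d) = pr (idx 3) d)"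
    by (simp add: al_conj z(1))
  then have "al z (\<lambda>d. T (f (pr m (pr (idx 1) d))) (g (pr n (pr (idx 1) d))))"
    by (rule al_mono[OF z(1)]) (elim conjE, simp)
  then show ?thesis
    using al_pr[OF z(1) idx_I[of 1], of "\<lambda>d. T (f (pr m d)) (g (pr n d))"]
      \<open>prs (idx 1) z = c\<close> by simp
qed

lemma rel_iff:
  assumes "c \<in> elts S" "i \<in> I" "k \<in> I" "prs i c = a" "prs k c = b" "a \<in> elts S" "b \<in> elts S"
  shows "rel T (f, a) (g, b) \<longleftrightarrow> al c (\<lambda>d. T (f (pr i d)) (g (pr k d)))"
proof
  assume "rel T (f, a) (g, b)"
  then obtain e m n where e: "e \<in> elts S" "m \<in> I" "n \<in> I" "prs m e = a" "prs n e = b"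
    "al e (\<lambda>d. T (f (pr m d)) (g (pr n d)))" unfolding rel_def by auto
  show "al c (\<lambda>d. T (f (pr i d)) (g (pr k d)))"
    by (rule rel_indep[where T = T and f = f and g = g, OF e(1-3) assms(1-3) e(4) assms(4,6) e(5) assms(5,7) e(6)])
qed (use assms in \<open>auto simp: rel_def\<close>)

lemma rel_same:
  assumes "c \<in> elts S"
  shows "rel T (f, c) (g, c) \<longleftrightarrow> al c (\<lambda>d. T (f d) (g d))"
proof -
  obtain z where z: "z \<in> elts S" "prs (idx 0) z = c" using seq2[OF assms assms] by metis
  have "rel T (f, c) (g, c) \<longleftrightarrow> al z (\<lambda>d. T (f (pr (idx 0) d)) (g (pr (idx 0) d)))"
    using z assms by (intro rel_iff) auto
  also have "\<dots> \<longleftrightarrow> al c (\<lambda>d. T (f d) (g d))"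
    using al_pr[OF z(1) idx_I[of 0], of "\<lambda>d. T (f d) (g d)"] z(2) by simp
  finally show ?thesis .
qed

definition mem_rel :: "((('v \<Rightarrow> 'v) \<times> 'v) \<times> (('v \<Rightarrow> 'v) \<times> 'v)) set" where
  "mem_rel = {(x, y). rel (\<lambda>u v. u \<in> elts v) x y}"

text \<open>A descending sequence in the limit involves countably many seeds, and some \<open>d\<close> of the
  common seed turns it into a descending sequence of sets.\<close>

lemma wf_mem_rel: "wf mem_rel"
  unfolding wf_iff_no_infinite_down_chain
proof
  assume "\<exists>x. \<forall>n. (x (Suc n), x n) \<in> mem_rel"
  then obtain x where x: "\<And>n. rel (\<lambda>u v. u \<in> elts v) (x (Suc n)) (x n)"
    by (auto simp: mem_rel_def)
  have S: "snd (x n) \<in> elts S" for n using x[of n] by (simp add: rel_def)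
  then obtain c where c: "c \<in> elts S" "\<And>n. prs (idx n) c = snd (x n)" using seq_nat[of "\<lambda>n. snd (x n)"] by blast
  have "al c (\<lambda>d. fst (x (Suc n)) (pr (idx (Suc n)) d) \<in> elts (fst (x n) (pr (idx n) d)))" for n
    using rel_iff[OF c(1) idx_I idx_I c(2) c(2) S S, of "\<lambda>u v. u \<in> elts v" "fst (x (Suc n))" "Suc n" "fst (x n)" n]
      x[of n] by simp
  then have "al c (\<lambda>d. \<forall>n. fst (x (Suc n)) (pr (idx (Suc n)) d) \<in> elts (fst (x n) (pr (idx n) d)))"
    by (simp add: al_all_nat[OF c(1)])
  then obtain d where "\<forall>n. fst (x (Suc n)) (pr (idx (Suc n)) d) \<in> elts (fst (x n) (pr (idx n) d))"
    using al_imp_ex[OF c(1)] by blast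
  then have "\<exists>y. \<forall>n. (y (Suc n), y n) \<in> {(u, v). u \<in> elts (v::'v)}"
    by (intro exI[of _ "\<lambda>n. fst (x n) (pr (idx n) d)"]) simp
  then show False using foundation[where 'a = 'v] unfolding wf_iff_no_infinite_down_chain by blast
qed

section \<open>The transitive collapse of the limit\<close>

text \<open>The Mostowski collapse. The \<open>vset\<close> has the intended members only once the
  values at the predecessors form a small class, which is \<open>small_collapse\<close>.\<close>

definition collapse :: "('v \<Rightarrow> 'v) \<times> 'v \<Rightarrow> 'v" where
  "collapse = wfrec mem_rel (\<lambda>h x. vset (h ` {y. (y, x) \<in> mem_rel}))"

lemma collapse_unfold: "collapse x = vset (collapse ` {y. (y, x) \<in> mem_rel})"
proof -
  have "collapse x = vset (cut collapse mem_rel x ` {y. (y, x) \<in> mem_rel})"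
    unfolding collapse_def by (rule wfrec[OF wf_mem_rel])
  also have "cut collapse mem_rel x ` {y. (y, x) \<in> mem_rel} = collapse ` {y. (y, x) \<in> mem_rel}"
    by (rule image_cong) (auto simp: cut_apply)
  finally show ?thesis .
qed

lemma collapse_cong: "(\<And>y. (y, x) \<in> mem_rel \<longleftrightarrow> (y, x') \<in> mem_rel) \<Longrightarrow> collapse x = collapse x'"
  using collapse_unfold[of x] collapse_unfold[of x'] by simp

definition val :: "('v \<Rightarrow> 'v) \<Rightarrow> 'v \<Rightarrow> 'v" where
  "val f a = collapse (f, a)"

lemma mem_rel_iff:
  assumes "c \<in> elts S" "i \<in> I" "k \<in> I" "prs i c \<in> elts S" "prs k c \<in> elts S"
  shows "((f, prs i c), (g, prs k c)) \<in> mem_rel \<longleftrightarrow> al c (\<lambda>d. f (pr i d) \<in> elts (g (pr k d)))"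
  using rel_iff[OF assms(1-3) refl refl assms(4,5), of "\<lambda>u v. u \<in> elts v"] by (simp add: mem_rel_def)

lemma mem_rel_same:
  "c \<in> elts S \<Longrightarrow> ((f, c), (g, c)) \<in> mem_rel \<longleftrightarrow> al c (\<lambda>d. f d \<in> elts (g d))"
  using rel_same[of c "\<lambda>u v. u \<in> elts v"] by (simp add: mem_rel_def)

lemma mem_rel_S: "(x, y) \<in> mem_rel \<Longrightarrow> snd x \<in> elts S \<and> snd y \<in> elts S"
  by (simp add: mem_rel_def rel_def)

text \<open>Compatibility with the maps of the directed system: composing with a decoding moves a
  function from the component to \<open>c\<close>. An arbitrary predecessor with seed
  \<open>b\<close> is tested at a seed coding \<open>b\<close>, \<open>c\<close> and the
  component.\<close>

lemma val_pr:
  assumes c: "c \<in> elts S" "i \<in> I" "prs i c \<in> elts S"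
  shows "val (\<lambda>d. f (pr i d)) c = val f (prs i c)"
  unfolding val_def
proof (rule collapse_cong)
  fix y :: "('v \<Rightarrow> 'v) \<times> 'v"
  obtain h b where y: "y = (h, b)" by fastforce
  show "(y, (\<lambda>d. f (pr i d), c)) \<in> mem_rel \<longleftrightarrow> (y, (f, prs i c)) \<in> mem_rel"
  proof (cases "b \<in> elts S")
    case b: True
    define x where "x j = (if j = 0 then b else if j = (1::nat) then c else prs i c)" for j
    have "x j \<in> elts S" for j using b c by (simp add: x_def)
    then obtain z where z: "z \<in> elts S" "\<And>j. prs (idx j) z = x j" using seq_nat by blast
    then have z': "prs (idx 0) z = b" "prs (idx 1) z = c" "prs (idx 2) z = prs i c"
      by (auto simp: x_def)
    have "(y, (\<lambda>d. f (pr i d), c)) \<in> mem_rel \<longleftrightarrow>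
        al z (\<lambda>d. h (pr (idx 0) d) \<in> elts (f (pr i (pr (idx 1) d))))"
      using mem_rel_iff[OF z(1) idx_I[of 0] idx_I[of 1], of h "\<lambda>d. f (pr i d)"] z' b c y by simp
    also have "\<dots> \<longleftrightarrow> al z (\<lambda>d. h (pr (idx 0) d) \<in> elts (f (pr (idx 2) d)))"
    proof (rule al_cong[OF z(1)])
      have "al z (\<lambda>d. pr i (pr (idx 1) d) = pr (idx 2) d)"
        using al_pr_eq[OF z(1) c(2) idx_I idx_I, of 1 2] z' by simp
      then show "al z (\<lambda>d. (h (pr (idx 0) d) \<in> elts (f (pr i (pr (idx 1) d)))) =
          (h (pr (idx 0) d) \<in> elts (f (pr (idx 2) d))))"
        by (rule al_mono[OF z(1)]) simp
    qed
    also have "\<dots> \<longleftrightarrow> (y, (f, prs i c)) \<in> mem_rel"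
      using mem_rel_iff[OF z(1) idx_I[of 0] idx_I[of 2], of h f] z' b c y by simp
    finally show ?thesis .
  qed (use mem_rel_S y in force)
qed

lemma val_cong:
  assumes c: "c \<in> elts S" and eq: "al c (\<lambda>d. f d = g d)"
  shows "val f c = val g c"
  unfolding val_def
proof (rule collapse_cong)
  fix y :: "('v \<Rightarrow> 'v) \<times> 'v"
  obtain h b where y: "y = (h, b)" by fastforce
  show "(y, (f, c)) \<in> mem_rel \<longleftrightarrow> (y, (g, c)) \<in> mem_rel"
  proof (cases "b \<in> elts S")
    case b: True
    obtain z where z: "z \<in> elts S" "prs (idx 0) z = b" "prs (idx 1) z = c" by (rule seq2[OF b c])
    have "al z (\<lambda>d. f (pr (idx 1) d) = g (pr (idx 1) d))"
      using al_pr[OF z(1) idx_I[of 1], of "\<lambda>d. f d = g d"] eq z by simp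
    then have "al z (\<lambda>d. (h (pr (idx 0) d) \<in> elts (f (pr (idx 1) d))) =
        (h (pr (idx 0) d) \<in> elts (g (pr (idx 1) d))))"
      by (rule al_mono[OF z(1)]) simp
    then have "al z (\<lambda>d. h (pr (idx 0) d) \<in> elts (f (pr (idx 1) d))) =
        al z (\<lambda>d. h (pr (idx 0) d) \<in> elts (g (pr (idx 1) d)))"
      by (rule al_cong[OF z(1)])
    then show ?thesis
      using mem_rel_iff[OF z(1) idx_I[of 0] idx_I[of 1], of h] z b c y by simp
  qed (use mem_rel_S y in force)
qed

text \<open>Predecessors range over a proper class of functions \<open>h\<close>, but almost all
  values of \<open>h\<close> lie in a fixed set \<open>W\<close> and almost all arguments in
  \<open>D\<close>. Changing \<open>h\<close> elsewhere preserves its value, so extensional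
  functions from \<open>D\<close> to \<open>W\<close> suffice.\<close>

lemma small_collapse: "small (collapse ` {y. (y, (f, c)) \<in> mem_rel})"
proof -
  \<comment> \<open>The empty set is added as the default value for truncated functions.\<close>
  define W where "W = vset (insert (vset {}) (\<Union>d\<in>elts D. elts (f d)))"
  have "small ({vset {}} \<union> (\<Union>d\<in>elts D. elts (f d)))"
    by (intro small_Un small_singleton small_UN small_elts)
  then have W: "elts W = insert (vset {}) (\<Union>d\<in>elts D. elts (f d))" by (simp add: W_def)
  obtain z\<^sub>1 :: 'v where "(elts D \<rightarrow>\<^sub>E elts W) \<lesssim> elts z\<^sub>1" using lepoll_extensional by blast
  then obtain z\<^sub>2 :: 'v where "(elts D \<rightarrow>\<^sub>E elts W) \<times> elts S \<lesssim> elts z\<^sub>2"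
    using lepoll_Times_elts lepoll_refl by blast
  then have "small (collapse ` ((elts D \<rightarrow>\<^sub>E elts W) \<times> elts S))" by (rule small_lepoll)
  then show ?thesis
  proof (rule small_subset, intro subsetI)
    fix u assume "u \<in> collapse ` {y. (y, (f, c)) \<in> mem_rel}"
    then obtain h b where u: "u = val h b" and m: "((h, b), (f, c)) \<in> mem_rel"
      by (force simp: val_def)
    have b: "b \<in> elts S" and c: "c \<in> elts S" using mem_rel_S[OF m] by auto
    obtain z where z: "z \<in> elts S" "prs (idx 0) z = b" "prs (idx 1) z = c" by (rule seq2[OF b c])
    define g where "g = (\<lambda>d\<in>elts D. if h d \<in> elts W then h d else vset {})"
    have g: "g \<in> elts D \<rightarrow>\<^sub>E elts W" using W by (auto simp: g_def)
    have "al z (\<lambda>d. h (pr (idx 0) d) \<in> elts (f (pr (idx 1) d)))"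
      using mem_rel_iff[OF z(1) idx_I[of 0] idx_I[of 1], of h f] m z b c by simp
    moreover have "al z (\<lambda>d. pr (idx 0) d \<in> elts D)"
      using al_pr[OF z(1) idx_I, of "\<lambda>d. d \<in> elts D"] z al_D[OF b] by simp
    moreover have "al z (\<lambda>d. pr (idx 1) d \<in> elts D)"
      using al_pr[OF z(1) idx_I, of "\<lambda>d. d \<in> elts D"] z al_D[OF c] by simp
    ultimately have "al z (\<lambda>d. h (pr (idx 0) d) \<in> elts (f (pr (idx 1) d)) \<and>
        pr (idx 0) d \<in> elts D \<and> pr (idx 1) d \<in> elts D)"
      by (simp add: al_conj z(1))
    then have "al z (\<lambda>d. h (pr (idx 0) d) = g (pr (idx 0) d))"
      by (rule al_mono[OF z(1)]) (auto simp: g_def W)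
    then have "al b (\<lambda>d. h d = g d)"
      using al_pr[OF z(1) idx_I, of "\<lambda>d. h d = g d"] z by simp
    then have "u = val g b" using val_cong[OF b] u by simp
    then show "u \<in> collapse ` ((elts D \<rightarrow>\<^sub>E elts W) \<times> elts S)"
      using g b by (auto simp: val_def)
  qed
qed

lemma elts_val: "elts (val g c) = {val h b | h b. ((h, b), (g, c)) \<in> mem_rel}"
proof -
  have "elts (val g c) = collapse ` {y. (y, (g, c)) \<in> mem_rel}"
    unfolding val_def by (subst collapse_unfold) (simp add: small_collapse)
  also have "\<dots> = {val h b | h b. ((h, b), (g, c)) \<in> mem_rel}" by (auto simp: val_def)
  finally show ?thesis .
qed

text \<open>A normal form for members: after passing to a seed \<open>z\<close> that codes
  \<open>c\<close> as component 0, the member and the containing set can be compared at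
  \<open>z\<close> alone.\<close>

lemma elts_valE:
  assumes "y \<in> elts (val g c)"
  obtains z h where "z \<in> elts S" "prs (idx 0) z = c" "c \<in> elts S" "y = val h z"
    "al z (\<lambda>d. h d \<in> elts (g (pr (idx 0) d)))"
proof -
  obtain h b where hb: "y = val h b" "((h, b), (g, c)) \<in> mem_rel" using assms by (auto simp: elts_val)
  have b: "b \<in> elts S" and c: "c \<in> elts S" using mem_rel_S[OF hb(2)] by auto
  obtain z where z: "z \<in> elts S" "prs (idx 0) z = c" "prs (idx 1) z = b" by (rule seq2[OF c b])
  show ?thesis
  proof (rule that[of z "\<lambda>d. h (pr (idx 1) d)"])
    show "y = val (\<lambda>d. h (pr (idx 1) d)) z" using val_pr[OF z(1) idx_I[of 1]] z b hb by simp
    show "al z (\<lambda>d. h (pr (idx 1) d) \<in> elts (g (pr (idx 0) d)))"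
      using mem_rel_iff[OF z(1) idx_I[of 1] idx_I[of 0]] z b c hb by simp
  qed (use z c in auto)
qed

lemma val_mem_imp: "c \<in> elts S \<Longrightarrow> al c (\<lambda>d. f d \<in> elts (g d)) \<Longrightarrow> val f c \<in> elts (val g c)"
  using mem_rel_same[of c f g] unfolding elts_val by blast

text \<open>The collapse identifies only functions that agree almost everywhere. If \<open>f\<close>
  and \<open>g\<close> differ, pick \<open>h\<close> in one but not in the other; the value of
  \<open>h\<close> is also that of some \<open>h'\<close> in the other, and the induction hypothesis
  makes \<open>h\<close> and \<open>h'\<close> agree, a contradiction.\<close>

lemma val_eq_imp:
  "c \<in> elts S \<Longrightarrow> val f c = val g c \<Longrightarrow> al c (\<lambda>d. f d = g d)"
proof (induction "(f, c)" arbitrary: f g c rule: wf_induct_rule[OF wf_mem_rel])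
  case (1 f c)
  note c = \<open>c \<in> elts S\<close>
  let ?x = "idx 0"
  \<comment> \<open>Stated for \<open>p\<close> and \<open>q\<close> to serve both inclusions. The
    induction only descends below \<open>(f, c)\<close>, so its hypothesis is passed in as
    \<open>IH\<close>, with \<open>f\<close> as \<open>p\<close> in one use and as \<open>q\<close>
    in the other.\<close>
  have sub: "False" if ne: "al c (\<lambda>d. \<exists>u. u \<in> elts (p d) \<and> u \<notin> elts (q d))"
    and pq: "val p c = val q c"
    and IH: "\<And>h h' z. z \<in> elts S \<Longrightarrow> prs ?x z = c \<Longrightarrow> al z (\<lambda>d. h d \<in> elts (p (pr ?x d))) \<Longrightarrow>
       al z (\<lambda>d. h' d \<in> elts (q (pr ?x d))) \<Longrightarrow> val h z = val h' z \<Longrightarrow> al z (\<lambda>d. h d = h' d)" for p q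
  proof -
    define h where "h d = (SOME u. u \<in> elts (p d) \<and> u \<notin> elts (q d))" for d
    have h: "al c (\<lambda>d. h d \<in> elts (p d) \<and> h d \<notin> elts (q d))"
      using ne by (rule al_mono[OF c]) (unfold h_def, rule someI_ex)
    then have "al c (\<lambda>d. h d \<in> elts (p d))" by (rule al_mono[OF c]) simp
    then have "val h c \<in> elts (val q c)" using val_mem_imp[OF c] pq by metis
    then obtain z h' where z: "z \<in> elts S" "prs ?x z = c" "val h c = val h' z"
      "al z (\<lambda>d. h' d \<in> elts (q (pr ?x d)))" by (rule elts_valE)
    have hz: "al z (\<lambda>d. h (pr ?x d) \<in> elts (p (pr ?x d)) \<and> h (pr ?x d) \<notin> elts (q (pr ?x d)))"
      using al_pr[OF z(1) idx_I, of "\<lambda>d. h d \<in> elts (p d) \<and> h d \<notin> elts (q d)"] h z by simp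
    have "val (\<lambda>d. h (pr ?x d)) z = val h' z" using val_pr[OF z(1) idx_I] z c by metis
    moreover have "al z (\<lambda>d. h (pr ?x d) \<in> elts (p (pr ?x d)))" using hz by (simp add: al_conj z(1))
    ultimately have "al z (\<lambda>d. h (pr ?x d) = h' d)"
      using IH[of z "\<lambda>d. h (pr ?x d)" h'] z by simp
    with hz z(4) have "al z (\<lambda>d. (h (pr ?x d) \<in> elts (p (pr ?x d)) \<and> h (pr ?x d) \<notin> elts (q (pr ?x d))) \<and>
       h' d \<in> elts (q (pr ?x d)) \<and> h (pr ?x d) = h' d)"
      by (simp only: al_conj[OF z(1)])
    from al_imp_ex[OF z(1) this] show False by auto
  qed
  have IH: "al z (\<lambda>d. h d = h' d)"
    if z: "z \<in> elts S" "prs ?x z = c" "al z (\<lambda>d. h d \<in> elts (f (pr ?x d)))" "val h z = val h' z" for h h' z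
  proof (rule "1.hyps"[OF _ z(1) z(4)])
    \<comment> \<open>\<open>w\<close> codes \<open>z\<close> and \<open>c\<close> side by side, to
      exhibit \<open>(h, z)\<close> as a predecessor of \<open>(f, c)\<close>.\<close>
    obtain w where w: "w \<in> elts S" "prs (idx 0) w = z" "prs (idx 1) w = c" by (rule seq2[OF z(1) c])
    have "al w (\<lambda>d. h (pr (idx 0) d) \<in> elts (f (pr ?x (pr (idx 0) d))))"
      using al_pr[OF w(1) idx_I, of "\<lambda>d. h d \<in> elts (f (pr ?x d))"] w z by simp
    moreover have "al w (\<lambda>d. pr ?x (pr (idx 0) d) = pr (idx 1) d)"
      using al_pr_eq[OF w(1) idx_I idx_I idx_I, of 0 0 1] w z by simp
    ultimately have "al w (\<lambda>d. h (pr (idx 0) d) \<in> elts (f (pr ?x (pr (idx 0) d))) \<and> pr ?x (pr (idx 0) d) = pr (idx 1) d)"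
      by (simp add: al_conj[OF w(1)])
    then have "al w (\<lambda>d. h (pr (idx 0) d) \<in> elts (f (pr (idx 1) d)))"
      by (rule al_mono[OF w(1)]) auto
    then show "((h, z), (f, c)) \<in> mem_rel"
      using mem_rel_iff[OF w(1) idx_I[of 0] idx_I[of 1], of h f] w z c by simp
  qed
  show ?case
  proof (rule ccontr)
    assume "\<not> al c (\<lambda>d. f d = g d)"
    then have ne: "al c (\<lambda>d. f d \<noteq> g d)" by (simp add: al_not[OF c])
    show False
    proof (cases "al c (\<lambda>d. \<exists>u. u \<in> elts (f d) \<and> u \<notin> elts (g d))")
      case True
      then show False by (rule sub[OF _ "1.prems"(2)]) (rule IH)
    next
      case False
      then have "al c (\<lambda>d. \<not> (\<exists>u. u \<in> elts (f d) \<and> u \<notin> elts (g d)))"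
        using al_not[OF c, of "\<lambda>d. \<exists>u. u \<in> elts (f d) \<and> u \<notin> elts (g d)"] by blast
      then have "al c (\<lambda>d. f d \<noteq> g d \<and> \<not> (\<exists>u. u \<in> elts (f d) \<and> u \<notin> elts (g d)))"
        using ne by (intro al_conj[OF c, THEN iffD2] conjI)
      then have "al c (\<lambda>d. \<exists>u. u \<in> elts (g d) \<and> u \<notin> elts (f d))"
        by (rule al_mono[OF c]) (metis extensionality subset_antisym subsetI)
      moreover have "al z (\<lambda>d. h d = h' d)"
        if "z \<in> elts S" "prs ?x z = c" "al z (\<lambda>d. h' d \<in> elts (f (pr ?x d)))" "val h z = val h' z" for h h' z
      proof -
        have "al z (\<lambda>d. h' d = h d)" by (rule IH[OF that(1-3) that(4)[symmetric]])
        then show ?thesis by (rule al_mono[OF that(1)]) simp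
      qed
      ultimately show False by (intro sub[OF _ "1.prems"(2)[symmetric]])
    qed
  qed
qed

lemma val_eq_iff: "c \<in> elts S \<Longrightarrow> val f c = val g c \<longleftrightarrow> al c (\<lambda>d. f d = g d)"
  using val_cong val_eq_imp by blast

text \<open>For the forward direction, the member is represented by some \<open>h\<close> at a
  larger seed, and \<open>val_eq_imp\<close> lets \<open>f\<close> replace \<open>h\<close>
  there.\<close>

lemma val_mem_iff:
  assumes c: "c \<in> elts S"
  shows "val f c \<in> elts (val g c) \<longleftrightarrow> al c (\<lambda>d. f d \<in> elts (g d))"
proof
  assume "val f c \<in> elts (val g c)"
  then obtain z h where z: "z \<in> elts S" "prs (idx 0) z = c" "val f c = val h z"
    "al z (\<lambda>d. h d \<in> elts (g (pr (idx 0) d)))" by (rule elts_valE)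
  have "val (\<lambda>d. f (pr (idx 0) d)) z = val h z" using val_pr[OF z(1) idx_I] z c by metis
  then have "al z (\<lambda>d. f (pr (idx 0) d) = h d)" by (rule val_eq_imp[OF z(1)])
  with z(4) have "al z (\<lambda>d. h d \<in> elts (g (pr (idx 0) d)) \<and> f (pr (idx 0) d) = h d)"
    by (simp add: al_conj[OF z(1)])
  then have "al z (\<lambda>d. f (pr (idx 0) d) \<in> elts (g (pr (idx 0) d)))"
    by (rule al_mono[OF z(1)]) auto
  then show "al c (\<lambda>d. f d \<in> elts (g d))"
    using al_pr[OF z(1) idx_I, of "\<lambda>d. f d \<in> elts (g d)"] z by simp
qed (rule val_mem_imp[OF c])

section \<open>The theorem of Los and the canonical embedding\<close>

definition limit :: "'v set" where
  "limit = {val f a | f a. a \<in> elts S}"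

theorem los: "c \<in> elts S \<Longrightarrow>
  set_sat limit \<phi> (\<lambda>n. val (F n) c) \<longleftrightarrow> al c (\<lambda>d. set_sat UNIV \<phi> (\<lambda>n. F n d))"
proof (induction \<phi> arbitrary: F c)
  case (SMem m n)
  then show ?case by (simp add: val_mem_iff)
next
  case (SEq m n)
  then show ?case by (simp add: val_eq_iff)
next
  case (SNeg \<phi>)
  then show ?case by (simp add: al_not)
next
  case (SAnd \<phi> \<psi>)
  then show ?case by (simp add: al_conj)
next
  case (SEx n \<phi>)
  note c = \<open>c \<in> elts S\<close>
  have upd: "(\<lambda>m. val (F m) c)(n := val h c) = (\<lambda>m. val ((F(n := h)) m) c)" for F h c by auto
  have upd': "(\<lambda>m. F m d)(n := h d) = (\<lambda>m. (F(n := h)) m d)" for F :: "nat \<Rightarrow> 'v \<Rightarrow> 'v" and h d by auto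
  show ?case
  proof
    assume "set_sat limit (SEx n \<phi>) (\<lambda>n. val (F n) c)"
    then obtain h b where b: "b \<in> elts S" and hb: "set_sat limit \<phi> ((\<lambda>n. val (F n) c)(n := val h b))"
      by (auto simp: limit_def)
    \<comment> \<open>The witness may live at a new seed \<open>b\<close>, so the parameters are
      moved to a seed coding both \<open>c\<close> and \<open>b\<close> before the induction
      hypothesis applies.\<close>
    obtain z where z: "z \<in> elts S" "prs (idx 0) z = c" "prs (idx 1) z = b" by (rule seq2[OF c b])
    have "val h b = val (\<lambda>d. h (pr (idx 1) d)) z" using val_pr[OF z(1) idx_I[of 1]] z b by simp
    moreover have "val (F m) c = val (\<lambda>d. F m (pr (idx 0) d)) z" for m
      using val_pr[OF z(1) idx_I[of 0]] z c by simp
    ultimately have "set_sat limit \<phi> ((\<lambda>m. val (\<lambda>d. F m (pr (idx 0) d)) z)(n := val (\<lambda>d. h (pr (idx 1) d)) z))"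
      using hb by simp
    then have "al z (\<lambda>d. set_sat UNIV \<phi> (\<lambda>m. ((\<lambda>m d. F m (pr (idx 0) d))(n := \<lambda>d. h (pr (idx 1) d))) m d))"
      unfolding upd[of "\<lambda>m d. F m (pr (idx 0) d)"] SEx.IH[OF z(1)] .
    then have "al z (\<lambda>d. set_sat UNIV (SEx n \<phi>) (\<lambda>m. F m (pr (idx 0) d)))"
      unfolding upd'[symmetric] by (rule al_mono[OF z(1)]) auto
    then show "al c (\<lambda>d. set_sat UNIV (SEx n \<phi>) (\<lambda>n. F n d))"
      using al_pr[OF z(1) idx_I, of "\<lambda>d. set_sat UNIV (SEx n \<phi>) (\<lambda>n. F n d)"] z by simp
  next
    assume asm: "al c (\<lambda>d. set_sat UNIV (SEx n \<phi>) (\<lambda>n. F n d))"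
    \<comment> \<open>Choosing witnesses pointwise keeps the witness at the seed
      \<open>c\<close>.\<close>
    define h where "h d = (SOME u. set_sat UNIV \<phi> ((\<lambda>n. F n d)(n := u)))" for d
    have "al c (\<lambda>d. set_sat UNIV \<phi> ((\<lambda>n. F n d)(n := h d)))"
      using asm by (rule al_mono[OF c]) (unfold h_def, rule someI_ex, simp only: set_sat.simps bex_UNIV)
    then have "set_sat limit \<phi> ((\<lambda>n. val (F n) c)(n := val h c))"
      unfolding upd upd' by (simp only: SEx.IH[OF c])
    then show "set_sat limit (SEx n \<phi>) (\<lambda>n. val (F n) c)"
      using c by (auto simp: limit_def)
  qed
qed

lemma transitive_limit: "transitive_class limit"
  unfolding transitive_class_def limit_def using mem_rel_S by (fastforce simp: elts_val)

definition emb :: "'v \<Rightarrow> 'v" where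
  "emb v = val (\<lambda>_. v) (SOME a. a \<in> elts S)"

text \<open>Constant functions have the same value at all seeds, since any two seeds are components
  of a third.\<close>

lemma emb_eq:
  assumes "a \<in> elts S"
  shows "emb v = val (\<lambda>_. v) a"
proof -
  have b: "(SOME a. a \<in> elts S) \<in> elts S" (is "?b \<in> _") using S_nonempty some_in_eq by blast
  obtain z where z: "z \<in> elts S" "prs (idx 0) z = a" "prs (idx 1) z = ?b" by (rule seq2[OF assms b])
  show ?thesis
    using val_pr[OF z(1) idx_I[of 0], of "\<lambda>_. v"] val_pr[OF z(1) idx_I[of 1], of "\<lambda>_. v"] z assms b
    by (simp add: emb_def)
qed

lemma elementary_emb: "elementary_embedding emb limit"
proof -
  obtain a where a: "a \<in> elts S" using S_nonempty by blast
  have "set_sat UNIV \<phi> s \<longleftrightarrow> set_sat limit \<phi> (emb \<circ> s)" for \<phi> s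
    using los[OF a, of \<phi> "\<lambda>n _. s n"] a by (simp add: emb_eq[OF a] comp_def)
  moreover have "range emb \<subseteq> limit" using a by (auto simp: limit_def emb_eq[OF a])
  ultimately show ?thesis by (simp add: elementary_embedding_def)
qed

section \<open>Consequences of completeness\<close>

text \<open>The ultrafilters are complete for unions indexed by \<open>I\<close>
  (\<open>al_ex\<close>), so a function choosing from the family almost everywhere uses one fixed
  index. Pairs, fixed ordinals and closure under sequences all follow from this.\<close>

lemma elts_val_family:
  assumes c: "c \<in> elts S" and J: "J \<subseteq> I" and g: "\<And>d. elts (g d) = (\<lambda>i. G i d) ` J"
  shows "elts (val g c) = (\<lambda>i. val (G i) c) ` J"
proof (intro subset_antisym subsetI)
  fix y assume "y \<in> elts (val g c)"
  then obtain z h where z: "z \<in> elts S" "prs (idx 0) z = c" "y = val h z"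
    "al z (\<lambda>d. h d \<in> elts (g (pr (idx 0) d)))" by (rule elts_valE)
  then have "al z (\<lambda>d. \<exists>i\<in>I. i \<in> J \<and> h d = G i (pr (idx 0) d))"
    using J by (elim al_mono[OF z(1)]) (auto simp: g)
  then obtain i where "i \<in> I" and i: "al z (\<lambda>d. i \<in> J \<and> h d = G i (pr (idx 0) d))"
    by (auto simp: al_ex[OF z(1)])
  then have "i \<in> J" "al z (\<lambda>d. h d = G i (pr (idx 0) d))" using z(1) by (simp_all add: al_conj)
  then have "y = val (\<lambda>d. G i (pr (idx 0) d)) z" using val_cong[OF z(1)] z(3) by simp
  then have "y = val (G i) c" using val_pr[OF z(1) idx_I] z(2) c by simp
  then show "y \<in> (\<lambda>i. val (G i) c) ` J" using \<open>i \<in> J\<close> by blast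
next
  fix y assume "y \<in> (\<lambda>i. val (G i) c) ` J"
  then show "y \<in> elts (val g c)" using c by (auto simp: val_mem_iff g)
qed

lemma val_pair:
  assumes "c \<in> elts S"
  shows "val (\<lambda>d. vset {f d, g d}) c = vset {val f c, val g c}"
proof (rule extensionality)
  let ?G = "\<lambda>i. if i = idx 0 then f else g"
  have ne: "idx 0 \<noteq> idx 1" using inj_idx by (auto dest: injD)
  have "elts (val (\<lambda>d. vset {f d, g d}) c) = (\<lambda>i. val (?G i) c) ` {idx 0, idx 1}"
    by (rule elts_val_family[OF assms]) (use ne in auto)
  then show "elts (val (\<lambda>d. vset {f d, g d}) c) = elts (vset {val f c, val g c})"
    using ne by simp
qed

lemma val_vpair:
  "c \<in> elts S \<Longrightarrow> val (\<lambda>d. vpair (f d) (g d)) c = vpair (val f c) (val g c)"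
  using val_pair[of c f f] by (simp add: vpair_def val_pair)

lemma emb_fixed: "elts \<alpha> \<subseteq> I \<Longrightarrow> Ord \<alpha> \<Longrightarrow> emb \<alpha> = \<alpha>"
proof (induction \<alpha> rule: mem_induct)
  case (step \<alpha>)
  obtain a where a: "a \<in> elts S" using S_nonempty by blast
  have "elts (emb \<alpha>) = (\<lambda>i. emb i) ` elts \<alpha>"
    unfolding emb_eq[OF a] by (rule elts_val_family[OF a]) (use step in auto)
  also have "\<dots> = (\<lambda>i. i) ` elts \<alpha>"
  proof (rule image_cong)
    fix \<beta> assume "\<beta> \<in> elts \<alpha>"
    then show "emb \<beta> = \<beta>"
      using step.prems step.IH[of \<beta>] Ord_subset[of \<alpha> \<beta>] Ord_mem[of \<alpha> \<beta>] by blast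
  qed simp
  finally show ?case by (intro extensionality) simp
qed

text \<open>The seeds of all entries are coded into one seed \<open>c\<close>; at \<open>c\<close>,
  the function \<open>g\<close> assembles the sequence from the decoded components. The indices are
  right because they are fixed by \<open>emb\<close>.\<close>

lemma closed_limit:
  assumes \<nu>: "elts \<nu> \<subseteq> I" "Ord \<nu>"
  shows "closed_under_sequences \<nu> limit"
  unfolding closed_under_sequences_def
proof (intro allI impI)
  fix f assume f: "f ` elts \<nu> \<subseteq> limit"
  \<comment> \<open>Indices outside \<open>elts \<nu>\<close> receive an arbitrary seed, as
    \<open>seq\<close> needs one for every index in \<open>I\<close>.\<close>
  have "\<exists>F a. a \<in> elts S \<and> (i \<in> elts \<nu> \<longrightarrow> f i = val F a)" for i
    using f S_nonempty unfolding limit_def by (cases "i \<in> elts \<nu>") blast+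
  then obtain F a where Fa: "\<And>i. a i \<in> elts S" "\<And>i. i \<in> elts \<nu> \<Longrightarrow> f i = val (F i) (a i)" by metis
  obtain c where c: "c \<in> elts S" "\<And>i. i \<in> I \<Longrightarrow> prs i c = a i" using seq[of a] Fa by blast
  define g where "g d = vset ((\<lambda>i. vpair i (F i (pr i d))) ` elts \<nu>)" for d
  have "elts (val g c) = (\<lambda>i. val (\<lambda>d. vpair i (F i (pr i d))) c) ` elts \<nu>"
    by (rule elts_val_family[OF c(1) \<nu>(1)]) (simp add: g_def)
  also have "\<dots> = (\<lambda>i. vpair i (f i)) ` elts \<nu>"
  proof (rule image_cong)
    fix i assume i: "i \<in> elts \<nu>"
    then have "val (\<lambda>_. i) c = i"
      using \<nu> emb_fixed[of i] emb_eq[OF c(1)] Ord_subset[OF \<nu>(2) i] Ord_mem[OF \<nu>(2) i] by auto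
    moreover have "val (\<lambda>d. F i (pr i d)) c = f i"
      using val_pr[OF c(1), of i "F i"] \<nu>(1) i Fa c(2)[of i] by auto
    ultimately show "val (\<lambda>d. vpair i (F i (pr i d))) c = vpair i (f i)"
      by (simp add: val_vpair[OF c(1)])
  qed simp
  finally have "val g c = vset ((\<lambda>i. vpair i (f i)) ` elts \<nu>)" by (intro extensionality) simp
  moreover have "val g c \<in> limit" using c(1) by (auto simp: limit_def)
  ultimately show "vset ((\<lambda>i. vpair i (f i)) ` elts \<nu>) \<in> limit" by simp
qed

section \<open>Ordinals of the limit and the critical point\<close>

text \<open>\<open>Ord\<close> asks for transitivity of a set and of its members, so it is enough
  that \<open>val\<close> preserves transitivity, at \<open>c\<close> and at the seeds of the
  members.\<close>

lemma Ord_val: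
  assumes c: "c \<in> elts S" and f: "al c (\<lambda>d. Ord (f d))"
  shows "Ord (val f c)"
proof -
  have trans: "transitive_class (elts (val g b))"
    if b: "b \<in> elts S" and g: "al b (\<lambda>d. transitive_class (elts (g d)))" for g b
    unfolding transitive_class_def
  proof (intro ballI subsetI)
    fix y x assume "y \<in> elts (val g b)" "x \<in> elts y"
    from this(1) obtain z h where z: "z \<in> elts S" "prs (idx 0) z = b" "y = val h z"
      and h: "al z (\<lambda>d. h d \<in> elts (g (pr (idx 0) d)))" by (rule elts_valE)
    from \<open>x \<in> elts y\<close> obtain w k where w: "w \<in> elts S" "prs (idx 0) w = z" "x = val k w"
      and k: "al w (\<lambda>d. k d \<in> elts (h (pr (idx 0) d)))" unfolding z(3) by (rule elts_valE)
    let ?p = "\<lambda>d. pr (idx 0) (pr (idx 0) d)"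
    have lift: "al w (\<lambda>d. P (pr (idx 0) d)) \<longleftrightarrow> al z P" for P using al_pr[OF w(1) idx_I] w by simp
    have "al w (\<lambda>d. transitive_class (elts (g (?p d))))"
      using lift[of "\<lambda>d. transitive_class (elts (g (pr (idx 0) d)))"]
        al_pr[OF z(1) idx_I, of "\<lambda>d. transitive_class (elts (g d))"] z g by simp
    moreover have "al w (\<lambda>d. h (pr (idx 0) d) \<in> elts (g (?p d)))"
      using lift[of "\<lambda>d. h d \<in> elts (g (pr (idx 0) d))"] h by simp
    ultimately have "al w (\<lambda>d. transitive_class (elts (g (?p d))) \<and>
        h (pr (idx 0) d) \<in> elts (g (?p d)) \<and> k d \<in> elts (h (pr (idx 0) d)))"
      using k by (simp add: al_conj[OF w(1)])
    then have "al w (\<lambda>d. k d \<in> elts (g (?p d)))"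
      by (rule al_mono[OF w(1)]) (auto simp: transitive_class_def)
    moreover have "val (\<lambda>d. g (?p d)) w = val g b"
      using val_pr[OF w(1) idx_I[of 0], of "\<lambda>d. g (pr (idx 0) d)"] val_pr[OF z(1) idx_I[of 0], of g] w z b
      by simp
    ultimately show "x \<in> elts (val g b)" using val_mem_imp[OF w(1), of k "\<lambda>d. g (?p d)"] w(3) by simp
  qed
  show ?thesis
    unfolding Ord_def
  proof (intro conjI ballI)
    show "transitive_class (elts (val f c))"
      by (rule trans[OF c al_mono[OF c f]]) (simp add: Ord_def)
    fix y assume "y \<in> elts (val f c)"
    then obtain z h where z: "z \<in> elts S" "prs (idx 0) z = c" "y = val h z"
      and h: "al z (\<lambda>d. h d \<in> elts (f (pr (idx 0) d)))" by (rule elts_valE)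
    have "al z (\<lambda>d. Ord (f (pr (idx 0) d)))" using al_pr[OF z(1) idx_I, of "\<lambda>d. Ord (f d)"] z f by simp
    with h have "al z (\<lambda>d. h d \<in> elts (f (pr (idx 0) d)) \<and> Ord (f (pr (idx 0) d)))"
      by (simp add: al_conj[OF z(1)])
    then have "al z (\<lambda>d. transitive_class (elts (h d)))"
      by (rule al_mono[OF z(1)]) (auto simp: Ord_def)
    then show "transitive_class (elts y)" unfolding z(3) by (rule trans[OF z(1)])
  qed
qed

lemma Ord_emb: "Ord \<alpha> \<Longrightarrow> Ord (emb \<alpha>)"
proof -
  assume "Ord \<alpha>"
  obtain a where a: "a \<in> elts S" using S_nonempty by blast
  then show ?thesis using Ord_val[OF a, of "\<lambda>_. \<alpha>"] \<open>Ord \<alpha>\<close> by (simp add: emb_eq[OF a])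
qed

lemma emb_mem: "x \<in> elts y \<Longrightarrow> emb x \<in> elts (emb y)"
proof -
  assume "x \<in> elts y"
  moreover obtain a where a: "a \<in> elts S" using S_nonempty by blast
  ultimately show ?thesis by (simp add: emb_eq[OF a] val_mem_iff)
qed

text \<open>Let \<open>h\<close> map a smaller \<alpha> onto \<kappa>. A function \<open>f\<close>
  into \<kappa> factors almost everywhere as \<open>h\<close> after some \<open>g\<close> into
  \<alpha>. As \<alpha> and its members are fixed, \<open>g\<close> is almost everywhere constant,
  hence so is \<open>f\<close>. Then \<open>emb \<kappa>\<close> has no new members and \<kappa> is
  not moved.\<close>

lemma Card_critical_point:
  assumes crit: "critical_point emb \<kappa>"
  shows "Card \<kappa>"
  unfolding Card_def
proof (intro conjI ballI notI)
  show \<kappa>: "Ord \<kappa>" using crit by (simp add: critical_point_def)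
  have fixed: "emb \<alpha> = \<alpha>" if "\<alpha> \<in> elts \<kappa>" for \<alpha> using crit that by (simp add: critical_point_def)
  fix \<alpha> assume \<alpha>: "\<alpha> \<in> elts \<kappa>" and "elts \<alpha> \<approx> elts \<kappa>"
  then obtain h where h: "bij_betw h (elts \<alpha>) (elts \<kappa>)" by (auto simp: eqpoll_def)
  have "elts (emb \<kappa>) = elts \<kappa>"
  proof (intro subset_antisym subsetI)
    fix x assume "x \<in> elts \<kappa>"
    then show "x \<in> elts (emb \<kappa>)" using emb_mem[of x \<kappa>] fixed by simp
  next
    obtain a where a: "a \<in> elts S" using S_nonempty by blast
    fix x assume "x \<in> elts (emb \<kappa>)"
    then obtain z f where z: "z \<in> elts S" "x = val f z" and f: "al z (\<lambda>d. f d \<in> elts \<kappa>)"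
      unfolding emb_eq[OF a] by (rule elts_valE)
    define g where "g d = inv_into (elts \<alpha>) h (f d)" for d
    have gh: "al z (\<lambda>d. g d \<in> elts \<alpha> \<and> h (g d) = f d)"
      using f by (rule al_mono[OF z(1)])
        (use h in \<open>auto simp: g_def bij_betw_def inv_into_into f_inv_into_f\<close>)
    then have "al z (\<lambda>d. g d \<in> elts \<alpha>)" by (rule al_mono[OF z(1)]) simp
    then have "val g z \<in> elts (emb \<alpha>)" using emb_eq[OF z(1)] val_mem_iff[OF z(1)] by simp
    then have i: "val g z \<in> elts \<alpha>" (is "?i \<in> _") using fixed[OF \<alpha>] by simp
    then have "emb ?i = ?i" using Ord_trans[OF \<kappa> \<alpha>] fixed by simp
    then have "val g z = val (\<lambda>_. ?i) z" using emb_eq[OF z(1)] by simp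
    then have "al z (\<lambda>d. g d = ?i)" by (rule val_eq_imp[OF z(1)])
    with gh have "al z (\<lambda>d. (g d \<in> elts \<alpha> \<and> h (g d) = f d) \<and> g d = ?i)" by (simp add: al_conj[OF z(1)])
    then have "al z (\<lambda>d. f d = h ?i)" by (rule al_mono[OF z(1)]) auto
    then have "x = emb (h ?i)" using val_cong[OF z(1)] z(2) emb_eq[OF z(1)] by simp
    moreover have "h ?i \<in> elts \<kappa>" using h i by (auto simp: bij_betw_def)
    ultimately show "x \<in> elts \<kappa>" using fixed by simp
  qed
  then have "emb \<kappa> = \<kappa>" by (rule extensionality)
  then show False using crit by (simp add: critical_point_def)
qed

text \<open>A seed is sent to the value of the identity function at it.\<close>

lemma seeds_lepoll_emb: "{a \<in> elts S. al a (\<lambda>d. d \<in> elts u)} \<lesssim> elts (emb u)"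
proof -
  have "a = b" if ab: "a \<in> elts S" "b \<in> elts S" "val (\<lambda>d. d) a = val (\<lambda>d. d) b" for a b
  proof -
    \<comment> \<open>\<open>al_pr_eq\<close> compares an iterated decoding with a single one, so
      \<open>a\<close> is presented as a component of the component \<open>k\<close> of
      \<open>z\<close>.\<close>
    obtain k where k: "k \<in> elts S" "prs (idx 0) k = a" "prs (idx 1) k = a" by (rule seq2[OF ab(1,1)])
    define x where "x j = (if j = 0 then k else if j = (1::nat) then a else b)" for j
    have "x j \<in> elts S" for j using ab k by (simp add: x_def)
    then obtain z where z: "z \<in> elts S" "\<And>j. prs (idx j) z = x j" using seq_nat by blast
    have "val (\<lambda>d. pr (idx 1) d) z = val (\<lambda>d. pr (idx 2) d) z"
      using val_pr[OF z(1) idx_I[of 1], of "\<lambda>d. d"] val_pr[OF z(1) idx_I[of 2], of "\<lambda>d. d"] z ab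
      by (simp add: x_def)
    then have "al z (\<lambda>d. pr (idx 1) d = pr (idx 2) d)" by (rule val_eq_imp[OF z(1)])
    moreover have "al z (\<lambda>d. pr (idx 0) (pr (idx 0) d) = pr (idx 1) d)"
      using al_pr_eq[OF z(1) idx_I idx_I idx_I, of 0 0 1] z k by (simp add: x_def)
    ultimately have "al z (\<lambda>d. pr (idx 1) d = pr (idx 2) d \<and> pr (idx 0) (pr (idx 0) d) = pr (idx 1) d)"
      by (simp add: al_conj[OF z(1)])
    then have "al z (\<lambda>d. pr (idx 0) (pr (idx 0) d) = pr (idx 2) d)"
      by (rule al_mono[OF z(1)]) auto
    then show "a = b"
      using al_pr_eq[OF z(1) idx_I idx_I idx_I, of 0 0 2] z k by (simp add: x_def)
  qed
  then have "inj_on (val (\<lambda>d. d)) {a \<in> elts S. al a (\<lambda>d. d \<in> elts u)}" by (auto simp: inj_on_def)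
  moreover have "val (\<lambda>d. d) ` {a \<in> elts S. al a (\<lambda>d. d \<in> elts u)} \<subseteq> elts (emb u)"
    using emb_eq by (auto simp: val_mem_iff)
  ultimately show ?thesis unfolding lepoll_def by blast
qed

end

section \<open>A sentence describing seeds\<close>

text \<open>The logic has only indexed conjunctions; the two indices are the empty set and its
  singleton.\<close>

definition conj2 :: "'v::zfc_universe fm \<Rightarrow> 'v fm \<Rightarrow> 'v fm" where
  "conj2 \<phi> \<psi> = Conj {vset {}, vset {vset {}}} (\<lambda>i. if i = vset {} then \<phi> else \<psi>)"

definition imp :: "'v::zfc_universe fm \<Rightarrow> 'v fm \<Rightarrow> 'v fm" where
  "imp \<phi> \<psi> = Neg (conj2 \<phi> (Neg \<psi>))"

definition iff :: "'v::zfc_universe fm \<Rightarrow> 'v fm \<Rightarrow> 'v fm" where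
  "iff \<phi> \<psi> = conj2 (imp \<phi> \<psi>) (imp \<psi> \<phi>)"

lemma vset_singleton_ne [simp]: "vset {x} \<noteq> vset {}"
proof
  assume "vset {x} = vset {}"
  then have "elts (vset {x}) = elts (vset {})" by (rule arg_cong)
  then show False by simp
qed

lemma sat_conj2 [simp]: "sat M (conj2 \<phi> \<psi>) s \<longleftrightarrow> sat M \<phi> s \<and> sat M \<psi> s"
  by (simp add: conj2_def)

lemma sat_imp [simp]: "sat M (imp \<phi> \<psi>) s \<longleftrightarrow> (sat M \<phi> s \<longrightarrow> sat M \<psi> s)"
  by (simp add: imp_def)

lemma sat_iff [simp]: "sat M (iff \<phi> \<psi>) s \<longleftrightarrow> (sat M \<phi> s \<longleftrightarrow> sat M \<psi> s)"
  by (auto simp: iff_def)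

lemma fv_conj2 [simp]: "fv (conj2 \<phi> \<psi>) = fv \<phi> \<union> fv \<psi>"
  by (auto simp: conj2_def split: if_splits)

lemma fv_imp [simp]: "fv (imp \<phi> \<psi>) = fv \<phi> \<union> fv \<psi>"
  by (simp add: imp_def)

lemma fv_iff [simp]: "fv (iff \<phi> \<psi>) = fv \<phi> \<union> fv \<psi>"
  by (auto simp: iff_def)

lemma is_fm_conj2 [simp]:
  "infinite (elts \<kappa>) \<Longrightarrow> is_fm \<kappa> \<mu> \<tau> (conj2 \<phi> \<psi>) \<longleftrightarrow> is_fm \<kappa> \<mu> \<tau> \<phi> \<and> is_fm \<kappa> \<mu> \<tau> \<psi>"
  by (auto simp: conj2_def finite_lesspoll_infinite)

lemma is_fm_imp [simp]:
  "infinite (elts \<kappa>) \<Longrightarrow> is_fm \<kappa> \<mu> \<tau> (imp \<phi> \<psi>) \<longleftrightarrow> is_fm \<kappa> \<mu> \<tau> \<phi> \<and> is_fm \<kappa> \<mu> \<tau> \<psi>"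
  by (simp add: imp_def)

lemma is_fm_iff [simp]:
  "infinite (elts \<kappa>) \<Longrightarrow> is_fm \<kappa> \<mu> \<tau> (iff \<phi> \<psi>) \<longleftrightarrow> is_fm \<kappa> \<mu> \<tau> \<phi> \<and> is_fm \<kappa> \<mu> \<tau> \<psi>"
  by (auto simp: iff_def)

lemma sat_All_single [simp]:
  "sat M (All {x} \<phi>) s \<longleftrightarrow> (\<forall>c\<in>elts (carrier M). sat M \<phi> (s(x := c)))"
proof -
  have "override_on s a {x} = s(x := a x)" for a by (auto simp: override_on_def)
  then show ?thesis by (auto simp del: fun_upd_apply)
qed

lemma sat_Ex_single [simp]:
  "sat M (Ex {x} \<phi>) s \<longleftrightarrow> (\<exists>c\<in>elts (carrier M). sat M \<phi> (s(x := c)))"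
proof -
  have "override_on s a {x} = s(x := a x)" for a by (auto simp: override_on_def)
  then show ?thesis by (auto simp del: fun_upd_apply)
qed

text \<open>
  The carrier consists of the subsets of \<open>D\<close>, where \<open>D\<close> is the power set of \<open>\<eta>\<close>, and \<open>E\<close> is
  membership. Since every element of \<open>D\<close> is an element of the carrier, \<open>D\<close> is defined by
  \<open>\<exists>y. E x y\<close>. The unary functions \<open>f n i k m\<close> are, for \<open>n = 0, ..., 5\<close>: the decoding of
  \<open>I\<close>-sequences in \<open>D\<close>; the set of elements outside some component of an \<open>I\<close>-sequence of sets;
  the decoding of \<open>I\<close>-sequences of sets; preimages under the decoding; equalizers of decodings; and
  the constant function \<open>\<eta>\<close>. All statements are universal in the sets involved, hence apply to the
  sets of the original structure in every extension.
\<close>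

definition seed_axioms ::
  "'v set \<Rightarrow> 'v \<Rightarrow> 'v set \<Rightarrow> (nat \<Rightarrow> 'v \<Rightarrow> 'v \<Rightarrow> 'v \<Rightarrow> 'v \<Rightarrow> 'v) \<Rightarrow> ('v \<Rightarrow> 'v \<Rightarrow> bool) \<Rightarrow> bool" where
  "seed_axioms I o' C f E \<longleftrightarrow>
     (\<forall>x\<in>C. \<forall>y\<in>C. (\<forall>z\<in>C. E z x \<longleftrightarrow> E z y) \<longrightarrow> x = y) \<and>
     (\<forall>a. a ` I \<subseteq> C \<longrightarrow> (\<forall>i\<in>I. \<exists>y\<in>C. E (a i) y) \<longrightarrow>
        (\<exists>x\<in>C. (\<exists>y\<in>C. E x y) \<and> (\<forall>i\<in>I. f 0 i i i x = a i))) \<and>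
     (\<forall>x\<in>C. \<forall>X\<in>C. (\<exists>y\<in>C. E x y) \<longrightarrow> (E x (f 1 o' o' o' X) \<longleftrightarrow> (\<exists>i\<in>I. \<not> E x (f 2 i i i X)))) \<and>
     (\<forall>x\<in>C. \<forall>X\<in>C. (\<exists>y\<in>C. E x y) \<longrightarrow> (\<forall>i\<in>I. E x (f 3 i i i X) \<longleftrightarrow> E (f 0 i i i x) X)) \<and>
     (\<forall>x\<in>C. \<forall>X\<in>C. (\<exists>y\<in>C. E x y) \<longrightarrow> (\<forall>i\<in>I. \<forall>k\<in>I. \<forall>m\<in>I.
        E x (f 4 i k m X) \<longleftrightarrow> f 0 i i i (f 0 k k k x) = f 0 m m m x)) \<and>
     (\<forall>x\<in>C. \<forall>y\<in>C. \<forall>z\<in>C. \<forall>X\<in>C. E x y \<and> E y z \<longrightarrow> E x (f 5 o' o' o' X))"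

text \<open>The formal counterpart of \<open>seed_axioms\<close>. The elements of \<open>I\<close>
  double as variables, so that one block \<open>All I\<close> quantifies over an
  \<open>I\<close>-sequence; the variables \<open>x n\<close> are kept apart from them.\<close>

definition seed_sentence ::
  "'v::zfc_universe set \<Rightarrow> 'v \<Rightarrow> (nat \<Rightarrow> 'v \<Rightarrow> 'v \<Rightarrow> 'v \<Rightarrow> 'v) \<Rightarrow> 'v \<Rightarrow> (nat \<Rightarrow> 'v) \<Rightarrow> 'v fm" where
  "seed_sentence I o' sm e x = (let
      v = (\<lambda>n. Var (x n));
      app = (\<lambda>n i k m t. App (sm n i k m) [t]);
      E = (\<lambda>s t. Rel e [s, t]);
      D = (\<lambda>t. Ex {x 4} (E t (v 4)))
    in
    conj2 (All {x 0} (All {x 1} (imp (All {x 2} (iff (E (v 2) (v 0)) (E (v 2) (v 1)))) (Equal (v 0) (v 1)))))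
    (conj2 (All I (imp (Conj I (\<lambda>i. D (Var i)))
      (Ex {x 0} (conj2 (D (v 0)) (Conj I (\<lambda>i. Equal (app 0 i i i (v 0)) (Var i)))))))
    (conj2 (All {x 0} (All {x 1} (imp (D (v 0))
      (iff (E (v 0) (app 1 o' o' o' (v 1))) (Disj I (\<lambda>i. Neg (E (v 0) (app 2 i i i (v 1)))))))))
    (conj2 (All {x 0} (All {x 1} (imp (D (v 0))
      (Conj I (\<lambda>i. iff (E (v 0) (app 3 i i i (v 1))) (E (app 0 i i i (v 0)) (v 1)))))))
    (conj2 (All {x 0} (All {x 1} (imp (D (v 0)) (Conj I (\<lambda>i. Conj I (\<lambda>k. Conj I (\<lambda>m.
      iff (E (v 0) (app 4 i k m (v 1)))
          (Equal (app 0 i i i (app 0 k k k (v 0))) (app 0 m m m (v 0))))))))))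
    (All {x 0} (All {x 1} (All {x 2} (All {x 3} (imp (conj2 (E (v 0) (v 1)) (E (v 1) (v 2)))
      (E (v 0) (app 5 o' o' o' (v 3)))))))))))))"

lemma seed_sentence_L_sentence:
  assumes "infinite (elts \<kappa>)" "I \<prec> elts \<kappa>" "o' \<in> I"
    and "\<And>n i k m. i \<in> I \<Longrightarrow> k \<in> I \<Longrightarrow> m \<in> I \<Longrightarrow> sm n i k m \<in> elts (fun_syms \<tau>)"
    and "\<And>g. fun_arity \<tau> g = 1" "e \<in> elts (rel_syms \<tau>)" "rel_arity \<tau> e = 2"
  shows "L_sentence \<kappa> \<kappa> \<tau> (seed_sentence I o' sm e x)"
proof -
  have [simp]: "{y} \<prec> elts \<kappa>" for y :: 'a using assms(1) by (simp add: finite_lesspoll_infinite)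
  show ?thesis
    unfolding L_sentence_def
  proof
    show "is_fm \<kappa> \<kappa> \<tau> (seed_sentence I o' sm e x)"
      using assms by (simp add: seed_sentence_def Let_def)
    show "fv (seed_sentence I o' sm e x) = {}"
      by (auto simp: seed_sentence_def Let_def)
  qed
qed

text \<open>The hypotheses on \<open>x\<close> prevent capture among the single variables and
  between these and the block \<open>I\<close>.\<close>

lemma sat_seed_sentence:
  fixes x :: "nat \<Rightarrow> 'v::zfc_universe"
  assumes x: "inj x" "range x \<inter> I = {}"
  shows "sat M (seed_sentence I o' sm e x) s \<longleftrightarrow>
    seed_axioms I o' (elts (carrier M)) (\<lambda>n i k m y. fun_int M (sm n i k m) [y])
      (\<lambda>y z. rel_int M e [y, z])"
proof -
  have [simp]: "x m = x n \<longleftrightarrow> m = n" for m n using x(1) by (simp add: inj_eq)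
  have xI: "x n \<noteq> i" if "i \<in> I" for n i using x(2) that by blast
  have [simp]: "(override_on s a I) i = a i" if "i \<in> I" for s a :: "'v \<Rightarrow> 'v" and i
    using that by (simp add: override_on_def)
  show ?thesis
    unfolding seed_axioms_def seed_sentence_def Let_def sat_conj2 sat_All_single
    \<comment> \<open>The general quantifier rules are switched off in favour of the single-variable
      ones; only the block \<open>I\<close> keeps the general rule.\<close>
    by (intro conj_cong refl; simp add: xI xI[symmetric] sat.simps(6)[of M I] del: sat.simps(6,7) cong: ball_cong bex_cong)
qed

lemma L_models_seed_sentence:
  assumes "inj x" "range x \<inter> I = {}" "elts (carrier M) \<noteq> {}"
  shows "L_models M (seed_sentence I o' sm e x) \<longleftrightarrow>
    seed_axioms I o' (elts (carrier M)) (\<lambda>n i k m y. fun_int M (sm n i k m) [y])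
      (\<lambda>y z. rel_int M e [y, z])"
proof -
  obtain c where "c \<in> elts (carrier M)" using assms(3) by blast
  then have "\<exists>s::'a \<Rightarrow> 'a. range s \<subseteq> elts (carrier M)" by (intro exI[of _ "\<lambda>_. c"]) auto
  then show ?thesis unfolding L_models_def sat_seed_sentence[OF assms(1,2)] by blast
qed

section \<open>The structure of subsets of the power set\<close>

lemma small_Collect [simp]: "small {y \<in> elts x. P y}"
  by (rule small_subset[OF small_elts]) blast

lemma small_Collect_Pow [simp]: "small {y. elts y \<subseteq> elts x \<and> P y}"
  using small_Collect[of "vPow x" P] by simp

text \<open>A pairing injection \<open>p\<close> codes a sequence of subsets as the set of all
  \<open>p (i, y)\<close> with \<open>y\<close> in the entry at \<open>i\<close>, and
  \<open>\<rho> i\<close> reads off the section at \<open>i\<close>.\<close>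

lemma ex_sequence_decoding:
  fixes h :: "'v::zfc_universe" and I :: "'v set"
  assumes "I \<times> elts h \<lesssim> elts h"
  shows "\<exists>\<rho>::'v \<Rightarrow> 'v \<Rightarrow> 'v. (\<forall>i x. elts (\<rho> i x) \<subseteq> elts h) \<and>
    (\<forall>X. (\<forall>i\<in>I. elts (X i) \<subseteq> elts h) \<longrightarrow> (\<exists>x. elts x \<subseteq> elts h \<and> (\<forall>i\<in>I. \<rho> i x = X i)))"
proof -
  obtain p where p: "inj_on p (I \<times> elts h)" "p ` (I \<times> elts h) \<subseteq> elts h"
    using assms by (auto simp: lepoll_def)
  define \<rho> where "\<rho> i x = vset {y \<in> elts h. p (i, y) \<in> elts x}" for i x
  have "\<exists>x. elts x \<subseteq> elts h \<and> (\<forall>i\<in>I. \<rho> i x = X i)" if X: "\<forall>i\<in>I. elts (X i) \<subseteq> elts h" for X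
  proof -
    define x where "x = vset {u \<in> elts h. \<exists>i\<in>I. \<exists>y\<in>elts (X i). u = p (i, y)}"
    have x: "elts x = {u \<in> elts h. \<exists>i\<in>I. \<exists>y\<in>elts (X i). u = p (i, y)}" by (simp add: x_def)
    have "\<rho> i x = X i" if i: "i \<in> I" for i
    proof (rule extensionality)
      have "p (i, y) \<in> elts x \<longleftrightarrow> y \<in> elts (X i)" if y: "y \<in> elts h" for y
      proof
        assume "p (i, y) \<in> elts x"
        then obtain k w where k: "k \<in> I" "w \<in> elts (X k)" "p (i, y) = p (k, w)" by (auto simp: x)
        then have "(i, y) = (k, w)" using X i y by (intro inj_onD[OF p(1)]) auto
        then show "y \<in> elts (X i)" using k by simp
      next
        assume "y \<in> elts (X i)"
        then show "p (i, y) \<in> elts x" using p(2) i y by (auto simp: x)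
      qed
      then show "elts (\<rho> i x) = elts (X i)" using X i by (auto simp: \<rho>_def)
    qed
    then show ?thesis by (intro exI[of _ x]) (auto simp: x)
  qed
  then show ?thesis by (intro exI[of _ \<rho>]) (auto simp: \<rho>_def)
qed

lemma lepoll_Pow_mono:
  assumes "A \<lesssim> B"
  shows "Pow A \<lesssim> Pow B"
proof -
  obtain f where "inj_on f A" "f ` A \<subseteq> B" using assms by (auto simp: lepoll_def)
  then have "inj_on ((`) f) (Pow A)" "(`) f ` Pow A \<subseteq> Pow B" by (auto intro: inj_on_image_Pow)
  then show ?thesis unfolding lepoll_def by blast
qed

text \<open>\<open>\<pi>\<close> decodes \<open>I\<close>-sequences of elements of \<open>D\<close>,
  \<open>\<rho>\<close> those of subsets of \<open>D\<close>. \<open>code\<close> names the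
  operations by elements of \<eta>, and \<open>var\<close> supplies variables outside
  \<open>I\<close>.\<close>

locale seed_structure =
  fixes \<eta> :: "'v::zfc_universe" and I :: "'v set" and o' :: 'v
    and \<pi> \<rho> :: "'v \<Rightarrow> 'v \<Rightarrow> 'v" and code :: "nat \<times> 'v \<times> 'v \<times> 'v \<Rightarrow> 'v" and var :: "nat \<Rightarrow> 'v"
  assumes Ord_\<eta>: "Ord \<eta>" and infinite_I: "infinite I" and I_lesspoll: "I \<prec> elts \<eta>" and o': "o' \<in> I"
    and \<pi>: "elts (\<pi> i x) \<subseteq> elts \<eta>"
    and \<pi>_surj: "(\<forall>i\<in>I. elts (X i) \<subseteq> elts \<eta>) \<Longrightarrow> \<exists>x. elts x \<subseteq> elts \<eta> \<and> (\<forall>i\<in>I. \<pi> i x = X i)"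
    and \<rho>: "elts (\<rho> i x) \<subseteq> elts (vPow \<eta>)"
    and \<rho>_surj: "(\<forall>i\<in>I. elts (X i) \<subseteq> elts (vPow \<eta>)) \<Longrightarrow>
      \<exists>x. elts x \<subseteq> elts (vPow \<eta>) \<and> (\<forall>i\<in>I. \<rho> i x = X i)"
    and code: "inj_on code (UNIV \<times> I \<times> I \<times> I)" "code ` (UNIV \<times> I \<times> I \<times> I) \<subseteq> elts \<eta>"
    and var: "inj var" "range var \<inter> I = {}"
begin

abbreviation D :: 'v where "D \<equiv> vPow \<eta>"

definition op :: "nat \<Rightarrow> 'v \<Rightarrow> 'v \<Rightarrow> 'v \<Rightarrow> 'v \<Rightarrow> 'v" where
  "op n i k m X = (
     if n = 0 then \<pi> i X
     else if n = 1 then vset {y \<in> elts D. \<exists>i\<in>I. y \<notin> elts (\<rho> i X)}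
     else if n = 2 then \<rho> i X
     else if n = 3 then vset {y \<in> elts D. \<pi> i y \<in> elts X}
     else if n = 4 then vset {y \<in> elts D. \<pi> i (\<pi> k y) = \<pi> m y}
     else \<eta>)"

definition sm :: "nat \<Rightarrow> 'v \<Rightarrow> 'v \<Rightarrow> 'v \<Rightarrow> 'v" where
  "sm n i k m = code (n, i, k, m)"

definition lang :: "'v language" where
  "lang = \<lparr>fun_syms = \<eta>, rel_syms = \<eta>, fun_arity = (\<lambda>_. 1), rel_arity = (\<lambda>_. 2)\<rparr>"

text \<open>A symbol that is not a code is decoded to an arbitrary tuple; this is harmless, as
  \<open>op\<close> always lands in the carrier. Every relation symbol means membership, so any of
  them can serve as \<open>E\<close>.\<close>

definition str :: "'v struct" where
  "str = \<lparr>carrier = vPow D,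
     fun_int = (\<lambda>g xs. case inv_into (UNIV \<times> I \<times> I \<times> I) code g of (n, i, k, m) \<Rightarrow> op n i k m (hd xs)),
     rel_int = (\<lambda>_ xs. xs ! 0 \<in> elts (xs ! 1))\<rparr>"

lemma lang_simps [simp]:
  "fun_syms lang = \<eta>" "rel_syms lang = \<eta>" "fun_arity lang g = 1" "rel_arity lang g = 2"
  by (simp_all add: lang_def)

lemma carrier_str [simp]: "carrier str = vPow D"
  by (simp add: str_def)

lemma rel_int_str [simp]: "rel_int str g [x, y] \<longleftrightarrow> x \<in> elts y"
  by (simp add: str_def)

lemma \<eta>_subset_D: "elts \<eta> \<subseteq> elts D"
  using Ord_subset[OF Ord_\<eta>] by auto

lemma D_subset_carrier: "elts D \<subseteq> elts (vPow D)"
  using \<eta>_subset_D by auto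

lemma op_in_carrier: "op n i k m X \<in> elts (vPow D)"
  using \<pi>[of i X] \<rho>[of i X] \<eta>_subset_D by (auto simp: op_def)

lemma is_struct_str: "is_struct lang str"
  unfolding is_struct_def
proof (intro conjI ballI allI impI)
  show "elts (carrier str) \<noteq> {}" using op_in_carrier unfolding carrier_str by blast
  show "fun_int str g xs \<in> elts (carrier str)" for g xs
    using op_in_carrier by (simp add: str_def split: prod.split)
qed

lemma fun_int_str:
  assumes "i \<in> I" "k \<in> I" "m \<in> I"
  shows "fun_int str (sm n i k m) [X] = op n i k m X"
  using inv_into_f_f[OF code(1), of "(n, i, k, m)"] assms by (simp add: str_def sm_def)

text \<open>\<open>D\<close> is itself a member of the carrier, so it witnesses the existential
  quantifier.\<close>

lemma ex_mem_carrier_iff: "(\<exists>y\<in>elts (vPow D). x \<in> elts y) \<longleftrightarrow> x \<in> elts D"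
  by (metis (no_types, lifting) elts_vPow mem_Collect_eq subsetD subset_refl)

lemma seed_axioms_str:
  "seed_axioms I o' (elts (carrier str)) (\<lambda>n i k m y. fun_int str (sm n i k m) [y])
     (\<lambda>y z. rel_int str e [y, z])"
proof -
  have ext: "x = y" if "x \<in> elts (vPow D)" "y \<in> elts (vPow D)"
    "\<forall>z\<in>elts (vPow D). z \<in> elts x \<longleftrightarrow> z \<in> elts y" for x y
  proof (rule extensionality)
    have "elts x \<subseteq> elts (vPow D)" "elts y \<subseteq> elts (vPow D)" using that D_subset_carrier by auto
    then show "elts x = elts y" using that(3) by blast
  qed
  have seq: "\<exists>x\<in>elts (vPow D). x \<in> elts D \<and> (\<forall>i\<in>I. op 0 i i i x = a i)"
    if "\<forall>i\<in>I. a i \<in> elts D" for a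
  proof -
    have "\<forall>i\<in>I. elts (a i) \<subseteq> elts \<eta>" using that by simp
    then obtain x where x: "elts x \<subseteq> elts \<eta>" "\<forall>i\<in>I. \<pi> i x = a i" using \<pi>_surj by blast
    then have "x \<in> elts D" by simp
    moreover from this have "x \<in> elts (vPow D)" using D_subset_carrier by blast
    ultimately show ?thesis by (intro bexI[of _ x] conjI) (use x in \<open>simp_all only: op_def if_True refl\<close>)
  qed
  show ?thesis
    unfolding seed_axioms_def carrier_str rel_int_str ex_mem_carrier_iff
  proof (intro conjI)
    show "\<forall>a. a ` I \<subseteq> elts (vPow D) \<longrightarrow> (\<forall>i\<in>I. a i \<in> elts D) \<longrightarrow>
        (\<exists>x\<in>elts (vPow D). x \<in> elts D \<and> (\<forall>i\<in>I. fun_int str (sm 0 i i i) [x] = a i))"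
      using seq by (simp add: fun_int_str)
  qed (use ext \<eta>_subset_D o' in \<open>simp add: fun_int_str op_def; blast\<close>)+
qed

definition sentence :: "'v fm" where
  "sentence = seed_sentence I o' sm (sm 0 o' o' o') var"

lemma sm_mem: "i \<in> I \<Longrightarrow> k \<in> I \<Longrightarrow> m \<in> I \<Longrightarrow> sm n i k m \<in> elts \<eta>"
  using code(2) by (auto simp: sm_def)

lemma L_sentence_sentence: "L_sentence \<eta> \<eta> lang sentence"
proof -
  have "infinite (elts \<eta>)"
    using infinite_I I_lesspoll infinite_le_lepoll lesspoll_imp_lepoll lepoll_trans by metis
  then show ?thesis
    unfolding sentence_def using I_lesspoll o' sm_mem by (intro seed_sentence_L_sentence) auto
qed

lemma L_models_str: "L_models str sentence"
  unfolding sentence_def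
proof (subst L_models_seed_sentence[OF var])
  show "elts (carrier str) \<noteq> {}" using op_in_carrier unfolding carrier_str by blast
qed (rule seed_axioms_str)

end

section \<open>Seeds in an extension\<close>

locale seed_extension = seed_structure +
  fixes N :: "'a struct"
  assumes struct_N: "is_struct lang N" and models_N: "L_models N sentence"
    and substructure_N: "substructure lang str N"
begin

abbreviation C :: "'a set" where "C \<equiv> elts (carrier N)"

definition E :: "'a \<Rightarrow> 'a \<Rightarrow> bool" where
  "E x y \<longleftrightarrow> rel_int N (sm 0 o' o' o') [x, y]"

definition opN :: "nat \<Rightarrow> 'a \<Rightarrow> 'a \<Rightarrow> 'a \<Rightarrow> 'a \<Rightarrow> 'a" where
  "opN n i k m x = fun_int N (sm n i k m) [x]"

definition seeds :: 'a where
  "seeds = vset {x \<in> C. \<exists>y\<in>C. E x y}"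

definition extent :: "('a \<Rightarrow> bool) \<Rightarrow> 'a" where
  "extent P = vset {y \<in> elts D. P y}"

text \<open>The extent is cut down to \<open>D\<close> so that any predicate becomes an element of
  the original carrier, to which \<open>E\<close> applies.\<close>

definition al :: "'a \<Rightarrow> ('a \<Rightarrow> bool) \<Rightarrow> bool" where
  "al a P \<longleftrightarrow> E a (extent P)"

lemma elts_seeds: "elts seeds = {x \<in> C. \<exists>y\<in>C. E x y}"
  by (simp add: seeds_def)

lemma elts_extent: "elts (extent P) = {y \<in> elts D. P y}"
  by (simp add: extent_def)

lemma extent_carrier: "extent P \<in> elts (vPow D)"
  using elts_extent[of P] by auto

lemma seed_axioms_N: "seed_axioms I o' C opN E"
proof -
  have "C \<noteq> {}" using struct_N by (simp add: is_struct_def)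
  from models_N[unfolded sentence_def L_models_seed_sentence[OF var this]] show ?thesis
    unfolding opN_def E_def .
qed

lemma carrier_subset: "elts (vPow D) \<subseteq> C"
  using substructure_N by (simp add: substructure_def)

lemma opN_eq:
  assumes "X \<in> elts (vPow D)" "i \<in> I" "k \<in> I" "m \<in> I"
  shows "opN n i k m X = op n i k m X"
proof -
  have "fun_int str (sm n i k m) [X] = fun_int N (sm n i k m) [X]"
    using substructure_N assms sm_mem[OF assms(2-4), of n] unfolding substructure_def by simp
  then show ?thesis using fun_int_str assms by (simp add: opN_def)
qed

lemma E_eq:
  assumes "x \<in> elts (vPow D)" "y \<in> elts (vPow D)"
  shows "E x y \<longleftrightarrow> x \<in> elts y"
proof -
  have "rel_int str (sm 0 o' o' o') xs \<longleftrightarrow> rel_int N (sm 0 o' o' o') xs"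
    if "length xs = 2" "set xs \<subseteq> elts (vPow D)" for xs
    using substructure_N that sm_mem[OF o' o' o', of 0] unfolding substructure_def by simp
  from this[of "[x, y]"] show ?thesis using assms by (simp add: E_def)
qed

lemma extensional_N: "x \<in> C \<Longrightarrow> y \<in> C \<Longrightarrow> (\<And>z. z \<in> C \<Longrightarrow> E z x \<longleftrightarrow> E z y) \<Longrightarrow> x = y"
  using seed_axioms_N[unfolded seed_axioms_def, THEN conjunct1] by blast

lemma seq_N:
  assumes "\<And>i. i \<in> I \<Longrightarrow> a i \<in> elts seeds"
  shows "\<exists>x\<in>elts seeds. \<forall>i\<in>I. opN 0 i i i x = a i"
proof -
  have "a ` I \<subseteq> C" "\<forall>i\<in>I. \<exists>y\<in>C. E (a i) y" using assms by (auto simp: elts_seeds)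
  then have "\<exists>x\<in>C. (\<exists>y\<in>C. E x y) \<and> (\<forall>i\<in>I. opN 0 i i i x = a i)"
    using seed_axioms_N[unfolded seed_axioms_def, THEN conjunct2, THEN conjunct1] by blast
  then show ?thesis unfolding elts_seeds by blast
qed

lemma nand_N:
  assumes "x \<in> elts seeds" "X \<in> C"
  shows "E x (opN 1 o' o' o' X) \<longleftrightarrow> (\<exists>i\<in>I. \<not> E x (opN 2 i i i X))"
  using seed_axioms_N[unfolded seed_axioms_def, THEN conjunct2, THEN conjunct2, THEN conjunct1] assms
  unfolding elts_seeds by blast

lemma pre_N:
  assumes "x \<in> elts seeds" "X \<in> C" "i \<in> I"
  shows "E x (opN 3 i i i X) \<longleftrightarrow> E (opN 0 i i i x) X"
  using seed_axioms_N[unfolded seed_axioms_def, THEN conjunct2, THEN conjunct2, THEN conjunct2, THEN conjunct1] assms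
  unfolding elts_seeds by blast

lemma eq_N:
  assumes "x \<in> elts seeds" "X \<in> C" "i \<in> I" "k \<in> I" "m \<in> I"
  shows "E x (opN 4 i k m X) \<longleftrightarrow> opN 0 i i i (opN 0 k k k x) = opN 0 m m m x"
  using seed_axioms_N[unfolded seed_axioms_def, THEN conjunct2, THEN conjunct2, THEN conjunct2, THEN conjunct2, THEN conjunct1] assms
  unfolding elts_seeds by blast

lemma base_N:
  assumes "x \<in> C" "y \<in> C" "z \<in> C" "X \<in> C" "E x y" "E y z"
  shows "E x (opN 5 o' o' o' X)"
  using seed_axioms_N[unfolded seed_axioms_def, THEN conjunct2, THEN conjunct2, THEN conjunct2, THEN conjunct2, THEN conjunct2] assms by blast

text \<open>Surjectivity of \<open>\<rho>\<close> names the whole family by one original set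
  \<open>X\<close>. Its components and the derived set are computed in the original structure, and
  the sentence applies them to the new element \<open>a\<close>.\<close>

lemma al_nand_N:
  assumes a: "a \<in> elts seeds"
  shows "al a (\<lambda>d. \<exists>i\<in>I. \<not> R i d) \<longleftrightarrow> (\<exists>i\<in>I. \<not> al a (R i))"
proof -
  have "\<forall>i\<in>I. elts (extent (R i)) \<subseteq> elts D" unfolding elts_extent by blast
  then obtain X where X: "elts X \<subseteq> elts D" "\<forall>i\<in>I. \<rho> i X = extent (R i)" using \<rho>_surj[of "\<lambda>i. extent (R i)"] by blast
  have XA: "X \<in> elts (vPow D)" using X(1) by (simp only: elts_vPow[of D] mem_Collect_eq)
  have "opN 2 i i i X = extent (R i)" if "i \<in> I" for i
    using X(2) that by (simp add: opN_eq[OF XA] op_def)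
  moreover have "opN 1 o' o' o' X = extent (\<lambda>d. \<exists>i\<in>I. \<not> R i d)"
  proof (rule extensionality)
    have "elts (opN 1 o' o' o' X) = {y \<in> elts D. \<exists>i\<in>I. y \<notin> elts (\<rho> i X)}"
      using o' by (simp add: opN_eq[OF XA] op_def)
    also have "\<dots> = {y \<in> elts D. \<exists>i\<in>I. \<not> R i y}"
      using X(2) by (auto simp: elts_extent)
    finally show "elts (opN 1 o' o' o' X) = elts (extent (\<lambda>d. \<exists>i\<in>I. \<not> R i d))" by (simp add: elts_extent)
  qed
  ultimately show ?thesis
    using nand_N[OF a subsetD[OF carrier_subset XA]] by (simp add: al_def)
qed

text \<open>The all-false family shows that exactly one of the true and the false condition is
  large. In the family of conditions \<open>k \<noteq> o'\<close>, both truth values occur, so one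
  member is not large, and \<open>al_nand_N\<close> makes the true condition large.\<close>

lemma al_D_N:
  assumes a: "a \<in> elts seeds"
  shows "al a (\<lambda>d. d \<in> elts D)"
proof -
  obtain i where i: "i \<in> I" "i \<noteq> o'"
    using infinite_I by (metis finite.emptyI finite_insert finite_subset insertCI subsetI)
  have "\<exists>i. i \<in> I" using o' by blast
  then have *: "al a (\<lambda>_. True) \<longleftrightarrow> \<not> al a (\<lambda>_. False)"
    using al_nand_N[OF a, of "\<lambda>_ _. False"] by simp
  have "(\<exists>k\<in>I. k = o')" using o' by blast
  then have "al a (\<lambda>_. True) \<longleftrightarrow> (\<exists>k\<in>I. \<not> al a (\<lambda>_. k \<noteq> o'))"
    using al_nand_N[OF a, of "\<lambda>k _. k \<noteq> o'"] by simp
  also have "\<dots>" using i o' * by (metis (full_types))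
  finally have "al a (\<lambda>_. True)" by simp
  moreover have "extent (\<lambda>d. d \<in> elts D) = extent (\<lambda>_. True)" by (simp add: extent_def)
  ultimately show ?thesis by (simp add: al_def)
qed

lemma seed_system_N:
  fixes idx :: "nat \<Rightarrow> 'a"
  assumes "inj idx" "range idx \<subseteq> I"
  shows "seed_system seeds D I al \<pi> (\<lambda>i. opN 0 i i i) idx"
proof
  \<comment> \<open>Old elements of \<open>D\<close> are seeds; the empty set is one.\<close>
  have "vset {} \<in> elts D" "D \<in> elts (vPow D)" "vset {} \<in> elts (vPow D)" by auto
  then show "elts seeds \<noteq> {}" using E_eq carrier_subset unfolding elts_seeds by blast
  show "inj idx" "\<And>n. idx n \<in> I" using assms by auto
  show "al a (\<lambda>d. d \<in> elts D)" if "a \<in> elts seeds" for a using that by (rule al_D_N)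
  show "al a (\<lambda>d. \<exists>i\<in>I. \<not> R i d) \<longleftrightarrow> (\<exists>i\<in>I. \<not> al a (R i))" if "a \<in> elts seeds" for a R
    using that by (rule al_nand_N)
  show "al a (\<lambda>d. P (\<pi> i d)) \<longleftrightarrow> al (opN 0 i i i a) P" if "a \<in> elts seeds" "i \<in> I" for a i P
  proof -
    have "opN 3 i i i (extent P) = extent (\<lambda>d. P (\<pi> i d))"
    proof (rule extensionality)
      show "elts (opN 3 i i i (extent P)) = elts (extent (\<lambda>d. P (\<pi> i d)))"
        using that \<pi> by (simp add: opN_eq[OF extent_carrier] op_def elts_extent)
    qed
    then show ?thesis
      using pre_N[OF _ subsetD[OF carrier_subset extent_carrier], of a i P] that by (simp add: al_def)
  qed
  show "\<exists>a\<in>elts seeds. \<forall>i\<in>I. opN 0 i i i a = x i" if "\<And>i. i \<in> I \<Longrightarrow> x i \<in> elts seeds" for x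
    using that by (rule seq_N)
  show "al a (\<lambda>d. \<pi> i (\<pi> k d) = \<pi> m d) \<longleftrightarrow> opN 0 i i i (opN 0 k k k a) = opN 0 m m m a"
    if "a \<in> elts seeds" "i \<in> I" "k \<in> I" "m \<in> I" for a i k m
  proof -
    \<comment> \<open>Operation 4 ignores its argument, so any original element such as
      \<open>D\<close> names the equalizer.\<close>
    have D: "D \<in> elts (vPow D)" by auto
    have "opN 4 i k m D = extent (\<lambda>d. \<pi> i (\<pi> k d) = \<pi> m d)"
      using that by (simp add: opN_eq[OF D] op_def extent_def)
    then show ?thesis using eq_N[OF _ subsetD[OF carrier_subset D], of a i k m] that by (simp add: al_def)
  qed
qed

text \<open>By extensionality, the elements of the extension are sets of seeds, and the seeds are sets of
  seeds below \<open>\<eta>\<close>.\<close>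

lemma carrier_lepoll: "C \<lesssim> Pow (Pow {a \<in> elts seeds. al a (\<lambda>d. d \<in> elts \<eta>)})"
proof -
  define U where "U = {a \<in> elts seeds. al a (\<lambda>d. d \<in> elts \<eta>)}"
  define p where "p x = {z \<in> C. E z x}" for x
  have inj: "inj_on p C"
    using extensional_N by (auto simp: inj_on_def p_def set_eq_iff)
  have "p ` C \<subseteq> Pow (elts seeds)" by (auto simp: p_def elts_seeds)
  with inj have 1: "C \<lesssim> Pow (elts seeds)" unfolding lepoll_def by blast
  have D: "D \<in> elts (vPow D)" by auto
  \<comment> \<open>Operation 5 names \<eta>, and \<eta> is the extent of its own membership
    predicate; thus \<open>base_N\<close> says that everything below a seed satisfies
    \<open>al\<close> for that predicate.\<close>
  have "extent (\<lambda>d. d \<in> elts \<eta>) = \<eta>"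
    using \<eta>_subset_D by (intro extensionality) (auto simp: elts_extent)
  moreover have "opN 5 o' o' o' D = \<eta>" using o' by (simp add: opN_eq[OF D] op_def)
  ultimately have "al z (\<lambda>d. d \<in> elts \<eta>)" if "z \<in> C" "x \<in> elts seeds" "E z x" for z x
    using base_N[OF _ _ _ subsetD[OF carrier_subset D], of z x] that
    unfolding al_def elts_seeds by auto
  then have "p ` elts seeds \<subseteq> Pow U" by (auto simp: p_def U_def elts_seeds)
  moreover have "inj_on p (elts seeds)" using inj by (rule inj_on_subset) (auto simp: elts_seeds)
  ultimately have "elts seeds \<lesssim> Pow U" unfolding lepoll_def by blast
  then have "Pow (elts seeds) \<lesssim> Pow (Pow U)" by (rule lepoll_Pow_mono)
  with 1 show ?thesis unfolding U_def by (rule lepoll_trans)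
qed

end

section \<open>Tallness\<close>

lemma ex_seed_structure:
  fixes \<eta> \<mu> :: "'v::zfc_universe"
  assumes \<eta>: "Card \<eta>" and \<mu>: "\<mu> \<in> elts \<eta>" "infinite (elts \<mu>)"
  shows "\<exists>o' \<pi> \<rho> code var. seed_structure \<eta> (elts \<mu>) o' \<pi> \<rho> code var"
proof -
  let ?I = "elts \<mu>" and ?H = "elts \<eta>"
  have Ord: "Ord \<eta>" using \<eta> by (rule Card_imp_Ord)
  have IH: "?I \<subseteq> ?H" using Ord_subset[OF Ord \<mu>(1)] .
  then have inf: "infinite ?H" using \<mu>(2) finite_subset by blast
  have IH': "?I \<lesssim> ?H" using IH by (rule subset_imp_lepoll)
  have HH: "?H \<times> ?H \<lesssim> ?H" using inf by (rule Times_same_lepoll)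
  have times: "A \<times> B \<lesssim> ?H" if "A \<lesssim> ?H" "B \<lesssim> ?H" for A :: "'b set" and B :: "'c set"
    using lepoll_trans[OF times_lepoll_mono[OF that] HH] .
  obtain \<pi> :: "'v \<Rightarrow> 'v \<Rightarrow> 'v" where \<pi>: "\<forall>i x. elts (\<pi> i x) \<subseteq> ?H"
    "\<forall>X. (\<forall>i\<in>?I. elts (X i) \<subseteq> ?H) \<longrightarrow> (\<exists>x. elts x \<subseteq> ?H \<and> (\<forall>i\<in>?I. \<pi> i x = X i))"
    using ex_sequence_decoding[OF times[OF IH' lepoll_refl]] by blast
  have HD: "?H \<subseteq> elts (vPow \<eta>)" using Ord_subset[OF Ord] by auto
  have "infinite (elts (vPow \<eta>))" using inf HD finite_subset by blast
  then have "elts (vPow \<eta>) \<times> elts (vPow \<eta>) \<lesssim> elts (vPow \<eta>)" by (rule Times_same_lepoll)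
  moreover have "?I \<times> elts (vPow \<eta>) \<lesssim> elts (vPow \<eta>) \<times> elts (vPow \<eta>)"
    by (rule subset_imp_lepoll) (use IH HD in blast)
  ultimately have "?I \<times> elts (vPow \<eta>) \<lesssim> elts (vPow \<eta>)" by (rule lepoll_trans[rotated])
  from ex_sequence_decoding[OF this]
  obtain \<rho> :: "'v \<Rightarrow> 'v \<Rightarrow> 'v" where \<rho>: "\<forall>i x. elts (\<rho> i x) \<subseteq> elts (vPow \<eta>)"
    "\<forall>X. (\<forall>i\<in>?I. elts (X i) \<subseteq> elts (vPow \<eta>)) \<longrightarrow>
      (\<exists>x. elts x \<subseteq> elts (vPow \<eta>) \<and> (\<forall>i\<in>?I. \<rho> i x = X i))"
    by blast
  have "(UNIV :: nat set) \<lesssim> ?H" using inf infinite_le_lepoll by blast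
  then have "(UNIV :: nat set) \<times> ?I \<times> ?I \<times> ?I \<lesssim> ?H" by (intro times IH')
  then obtain code where code: "inj_on code ((UNIV :: nat set) \<times> ?I \<times> ?I \<times> ?I)"
    "code ` (UNIV \<times> ?I \<times> ?I \<times> ?I) \<subseteq> ?H" by (auto simp: lepoll_def)
  obtain o' where o': "o' \<in> ?I" using \<mu>(2) infinite_imp_nonempty by blast
  \<comment> \<open>The variables must avoid \<open>?I\<close>. Its complement is infinite, since
    otherwise the universe would be a set.\<close>
  have "infinite (- ?I)"
  proof
    assume "finite (- ?I)"
    moreover obtain w :: 'v where "infinite (elts w)" using infinite_elts_ex by blast
    ultimately have "- ?I \<lesssim> elts w" by (rule finite_lepoll_infinite[rotated])
    then have "small (- ?I)" by (rule small_lepoll')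
    from small_Un[OF this small_elts[of \<mu>]] show False by (simp add: not_small_UNIV)
  qed
  then obtain var :: "nat \<Rightarrow> 'v" where var: "inj var" "range var \<subseteq> - ?I"
    using infinite_countable_subset by blast
  have "seed_structure \<eta> ?I o' \<pi> \<rho> code var"
  proof
    show "?I \<prec> ?H" using Card_mem_lesspoll[OF \<eta> \<mu>(1)] .
    show "\<exists>x. elts x \<subseteq> ?H \<and> (\<forall>i\<in>?I. \<pi> i x = X i)" if "\<forall>i\<in>?I. elts (X i) \<subseteq> ?H" for X
      using \<pi>(2) that by (elim allE impE)
    show "\<exists>x. elts x \<subseteq> elts (vPow \<eta>) \<and> (\<forall>i\<in>?I. \<rho> i x = X i)"
      if "\<forall>i\<in>?I. elts (X i) \<subseteq> elts (vPow \<eta>)" for X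
      using \<rho>(2) that by (elim allE impE)
    show "elts (\<pi> i x) \<subseteq> ?H" "elts (\<rho> i x) \<subseteq> elts (vPow \<eta>)" for i x
      using \<pi>(1) \<rho>(1) by simp_all
    show "range var \<inter> ?I = {}" using var(2) by blast
  qed (fact Ord \<mu>(2) o' code var(1))+
  then show ?thesis by blast
qed

text \<open>The extension is demanded larger than the double power set of \<open>z\<close>. If the
  seeds below \<eta> injected into \<open>z\<close>, then \<open>carrier_lepoll\<close> would make
  the extension too small.\<close>

lemma ex_seed_system:
  fixes \<eta> \<mu> z :: "'v::zfc_universe"
  assumes \<eta>: "Card \<eta>" and bound: "ULST_bound (L_sentence \<eta> \<eta>) L_models \<eta>"
    and \<mu>: "\<mu> \<in> elts \<eta>" "infinite (elts \<mu>)"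
  shows "\<exists>S D al pr prs idx. seed_system S D (elts \<mu>) al pr prs idx \<and>
    \<not> {a \<in> elts S. al a (\<lambda>d. d \<in> elts \<eta>)} \<lesssim> elts z"
proof -
  obtain o' \<pi> \<rho> code var where "seed_structure \<eta> (elts \<mu>) o' \<pi> \<rho> code var"
    using ex_seed_structure[OF \<eta> \<mu>] by blast
  then interpret seed_structure \<eta> "elts \<mu>" o' \<pi> \<rho> code var .
  obtain \<gamma> :: 'v where \<gamma>: "Card \<gamma>" "elts (carrier str) \<approx> elts \<gamma>" using ex_Card_eqpoll by blast
  have "elts \<eta> \<lesssim> elts (carrier str)"
    using \<eta>_subset_D D_subset_carrier by (intro subset_imp_lepoll) simp
  then have \<eta>\<gamma>: "ord_le \<eta> \<gamma>"
    using Card_lepoll_ord_le[OF \<eta> Card_imp_Ord[OF \<gamma>(1)]] lepoll_trans2[OF _ \<gamma>(2)] by blast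
  \<comment> \<open>\<open>y\<close> contains all that \<gamma>' has to exceed; its power set is
    strictly larger by Cantor's theorem.\<close>
  define y where "y = vset (elts \<gamma> \<union> elts (vPow (vPow z)))"
  have y: "elts y = elts \<gamma> \<union> elts (vPow (vPow z))" unfolding y_def by (intro elts_vset small_Un small_elts)
  obtain \<gamma>' :: 'v where \<gamma>': "Card \<gamma>'" "elts (vPow y) \<approx> elts \<gamma>'" using ex_Card_eqpoll by blast
  have less: "x \<prec> elts \<gamma>'" if "x \<subseteq> elts y" for x
  proof -
    have "x \<lesssim> elts y" using that by (rule subset_imp_lepoll)
    also have "elts y \<prec> Pow (elts y)" by (rule lesspoll_Pow_self)
    also have "Pow (elts y) \<approx> elts (vPow y)" by (rule Pow_eqpoll_vPow)
    also have "elts (vPow y) \<approx> elts \<gamma>'" by (rule \<gamma>'(2))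
    finally show ?thesis .
  qed
  have "\<gamma> \<in> elts \<gamma>'"
    by (rule Card_lesspoll_mem[OF Card_imp_Ord[OF \<gamma>(1)] Card_imp_Ord[OF \<gamma>'(1)] less]) (simp add: y)
  then obtain N where N: "is_struct lang N" "L_models N sentence" "elts \<gamma>' \<lesssim> elts (carrier N)"
    "substructure lang str N"
    using bound[unfolded ULST_bound_def, rule_format, of lang sentence str \<gamma> \<gamma>']
      L_sentence_sentence is_struct_str L_models_str \<gamma> \<gamma>'(1) \<eta>\<gamma> by blast
  then interpret seed_extension \<eta> "elts \<mu>" o' \<pi> \<rho> code var N by unfold_locales
  obtain idx :: "nat \<Rightarrow> 'v" where idx: "inj idx" "range idx \<subseteq> elts \<mu>"
    using infinite_countable_subset[OF \<mu>(2)] by blast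
  have "\<not> {a \<in> elts seeds. al a (\<lambda>d. d \<in> elts \<eta>)} \<lesssim> elts z"
  proof
    let ?U = "{a \<in> elts seeds. al a (\<lambda>d. d \<in> elts \<eta>)}"
    assume "?U \<lesssim> elts z"
    then have "Pow (Pow ?U) \<lesssim> Pow (Pow (elts z))" by (intro lepoll_Pow_mono)
    also have "Pow (Pow (elts z)) \<lesssim> Pow (elts (vPow z))"
      by (intro lepoll_Pow_mono eqpoll_imp_lepoll Pow_eqpoll_vPow)
    also have "Pow (elts (vPow z)) \<lesssim> elts (vPow (vPow z))"
      by (intro eqpoll_imp_lepoll Pow_eqpoll_vPow)
    finally have "Pow (Pow ?U) \<lesssim> elts (vPow (vPow z))" .
    from lepoll_trans[OF lepoll_trans[OF N(3) carrier_lepoll] this]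
    have "elts \<gamma>' \<lesssim> elts (vPow (vPow z))" .
    also have "elts (vPow (vPow z)) \<prec> elts \<gamma>'" by (rule less) (simp add: y)
    finally show False by simp
  qed
  then show ?thesis using seed_system_N[OF idx] by blast
qed

text \<open>The critical point is the least ordinal moved by \<open>emb\<close>. It is at most
  \<eta>, as \<eta> is moved, and above \<nu>, as every ordinal included in \<open>I\<close> is
  fixed.\<close>

lemma (in seed_system) tall_pushing_up_emb:
  assumes I: "I = elts \<mu>" "Ord \<mu>" and \<eta>: "Card \<eta>" and \<nu>: "Card \<nu>" "ord_le \<nu> \<mu>"
    and moved: "\<eta> \<in> elts (emb \<eta>)" and \<theta>: "\<theta> \<in> elts (emb \<eta>)"
  shows "\<exists>\<kappa>. Card \<kappa> \<and> \<nu> \<in> elts \<kappa> \<and> ord_le \<kappa> \<eta> \<and> tall_pushing_up \<kappa> \<theta> \<eta> \<nu>"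
proof -
  have \<nu>I: "elts \<nu> \<subseteq> I" using \<nu>(2) I Ord_subset by (auto simp: ord_le_def)
  have Ord\<nu>: "Ord \<nu>" using \<nu>(1) by (rule Card_imp_Ord)
  have "emb \<eta> \<noteq> \<eta>" using moved mem_irrefl by metis
  then obtain \<kappa> where \<kappa>: "emb \<kappa> \<noteq> \<kappa>" "Ord \<kappa>" "ord_le \<kappa> \<eta>" "\<forall>\<alpha>\<in>elts \<kappa>. emb \<alpha> = \<alpha>"
    using Ord_least[of "\<lambda>\<alpha>. emb \<alpha> \<noteq> \<alpha>" \<eta>] Card_imp_Ord[OF \<eta>] by blast
  then have crit: "critical_point emb \<kappa>" by (simp add: critical_point_def)
  have "\<nu> \<in> elts \<kappa>"
  proof (rule ccontr)
    assume "\<nu> \<notin> elts \<kappa>"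
    then have "elts \<kappa> \<subseteq> elts \<nu>" using Ord_not_mem[OF Ord\<nu> \<kappa>(2)] by blast
    then have "emb \<kappa> = \<kappa>" using \<nu>I \<kappa>(2) by (intro emb_fixed) auto
    then show False using \<kappa>(1) by simp
  qed
  moreover have "tall_pushing_up \<kappa> \<theta> \<eta> \<nu>"
    unfolding tall_pushing_up_def
  proof (intro conjI exI)
    show "ord_le \<nu> \<kappa>" using \<open>\<nu> \<in> elts \<kappa>\<close> by (simp add: ord_le_def)
    show "closed_under_sequences \<nu> limit" by (rule closed_limit[OF \<nu>I Ord\<nu>])
  qed (fact Card_critical_point[OF crit] \<eta> \<nu>(1) \<kappa>(3) transitive_limit elementary_emb crit \<theta>)+
  ultimately show ?thesis using Card_critical_point[OF crit] \<kappa>(3) by blast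
qed

theorem theorem8p20:
  fixes \<eta> :: "'v::zfc_universe"
  assumes "regular_Card \<eta>" and "uncountable (elts \<eta>)"
    and "is_ULST (L_sentence \<eta> \<eta>) L_models \<eta>"
  shows "supreme_for_tallness \<eta>"
proof -
  have \<eta>: "Card \<eta>" and bound: "ULST_bound (L_sentence \<eta> \<eta>) L_models \<eta>"
    using assms(3) by (simp_all add: is_ULST_def)
  have Ord\<eta>: "Ord \<eta>" using \<eta> by (rule Card_imp_Ord)
  \<comment> \<open>Only an infinite ordinal below \<eta> is needed, not the first one; it exists
    because \<eta> is uncountable.\<close>
  obtain \<omega> where \<omega>: "\<omega> \<in> elts \<eta>" "infinite (elts \<omega>)"
    using uncountable_Ord_infinite_mem[OF Ord\<eta> assms(2)] by blast
  have "\<exists>\<kappa>. Card \<kappa> \<and> \<nu> \<in> elts \<kappa> \<and> ord_le \<kappa> \<eta> \<and> tall_pushing_up \<kappa> \<theta> \<eta> \<nu>"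
    if \<nu>: "Card \<nu>" "\<nu> \<in> elts \<eta>" and \<theta>: "Ord \<theta>" for \<nu> \<theta>
  proof -
    \<comment> \<open>The larger of \<nu> and \<omega>: sequences must be infinite for the seed
      system and at least as long as \<nu> for the closure.\<close>
    have "\<exists>\<mu>\<in>elts \<eta>. infinite (elts \<mu>) \<and> ord_le \<nu> \<mu>"
    proof (cases "\<nu> \<in> elts \<omega>")
      case False
      then have "elts \<omega> \<subseteq> elts \<nu>" using Ord_not_mem Ord_mem[OF Ord\<eta>] \<omega>(1) \<nu>(2) by blast
      then show ?thesis using \<nu>(2) \<omega>(2) finite_subset by (auto simp: ord_le_def)
    qed (use \<omega> in \<open>auto simp: ord_le_def\<close>)
    then obtain \<mu> where \<mu>: "\<mu> \<in> elts \<eta>" "infinite (elts \<mu>)" "ord_le \<nu> \<mu>" by blast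
    \<comment> \<open>The seeds below \<eta> inject into \<open>emb \<eta>\<close> but not into
      \<open>z\<close>, so \<open>emb \<eta>\<close> exceeds every ordinal included in
      \<open>z\<close>, in particular \<theta> and \<eta>.\<close>
    define z where "z = vset (elts \<theta> \<union> elts \<eta>)"
    have z: "elts z = elts \<theta> \<union> elts \<eta>" unfolding z_def by (intro elts_vset small_Un small_elts)
    obtain S D al pr prs idx where sys: "seed_system S D (elts \<mu>) al pr prs idx"
      and big: "\<not> {a \<in> elts S. al a (\<lambda>d. d \<in> elts \<eta>)} \<lesssim> elts z"
      using ex_seed_system[OF \<eta> bound \<mu>(1,2), of z] by blast
    interpret seed_system S D "elts \<mu>" al pr prs idx by (rule sys)
    have "\<alpha> \<in> elts (emb \<eta>)" if "Ord \<alpha>" "elts \<alpha> \<subseteq> elts z" for \<alpha>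
    proof (rule ccontr)
      assume "\<alpha> \<notin> elts (emb \<eta>)"
      then have "elts (emb \<eta>) \<subseteq> elts z" using Ord_not_mem[OF that(1) Ord_emb[OF Ord\<eta>]] that(2) by blast
      then have "elts (emb \<eta>) \<lesssim> elts z" by (rule subset_imp_lepoll)
      from lepoll_trans[OF seeds_lepoll_emb this] show False using big by contradiction
    qed
    then have "\<eta> \<in> elts (emb \<eta>)" "\<theta> \<in> elts (emb \<eta>)" using Ord\<eta> \<theta> z by auto
    then show ?thesis
      using tall_pushing_up_emb[OF refl Ord_mem[OF Ord\<eta> \<mu>(1)] \<eta> \<nu>(1) \<mu>(3)] by blast
  qed
  then show ?thesis unfolding supreme_for_tallness_def using \<eta> by blast
qed

end
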